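(* Let $V=(v_0,v_1,v_2,v_3)\in(\mathbb{F}_2^3)^4$ be a 4-tuple of vectors in $\mathbb{F}_2^3$. Then in $\mathcal{C}(I^3)_{\mathbb{Q}}$ $$\mathrm{ldeg}(F_{v_0}F_{v_1}F_{v_2}F_{v_3})=\begin{cases} -64&\text{if }V=(100,010,001,111)^{\sigma,\tau}\text{ for some }\sigma\in S_4,\ \tau\in S_3,\\ -64&\text{if }V=(100,010,101,011)^{\sigma,\tau}\text{ for some }\sigma\in S_4,\ \tau\in S_3,\\ -64&\text{if }V=(100,110,101,111)^{\sigma,\tau}\text{ for some }\sigma\in S_4,\ \tau\in S_3,\\ 128&\text{if }V=(100,011,011,111)^{\sigma,\tau}\text{ for some }\sigma\in S_4,\ \tau\in S_3,\\ 128&\text{if }V=(100,111,111,111)^{\sigma,\tau}\text{ for some }\sigma\in S_4,\ \tau\in S_3,\\ 128&\text{if }V=(110,110,101,011)^{\sigma,\tau}\text{ for some }\sigma\in S_4,\ \tau\in S_3,\\ -128&\text{if }V=(110,101,111,111)^{\sigma,\tau}\text{ for some }\sigma\in S_4,\ \tau\in S_3,\\ 512&\text{if }V=(111,111,111,111)^{\sigma,\tau}\text{ for some }\sigma\in S_4,\ \tau\in S_3,\\ 0&\text{otherwise.}\end{cases}$$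
   Context: Vectors of $\mathbb{F}_2^3$ are written by concatenating digits, e.g. $101=(1,0,1)$. $S_3$ acts on $\mathbb{F}_2^3$ by permuting the standard basis ($v\mapsto v^\tau$), and for $\sigma\in S_4$ (permutations of $\{0,1,2,3\}$), $\tau\in S_3$ one sets $(v_0,\ldots,v_3)^{\sigma,\tau}:=(v_{\sigma(0)}^\tau,\ldots,v_{\sigma(3)}^\tau)$. For $d\ge1$, $\mathcal{C}(I^d)$ (the combinatorial Chow ring of the $d$-th power of the 1-simplex $I=\Delta[1]$) is the quotient of the graded polynomial ring $\mathbb{Z}[C_v\mid v\in\mathbb{F}_2^d]$ (generators of degree 1) by the ideal generated by: (1) $C_vC_w$ for all $v,w\in\mathbb{F}_2^d$ which are incomparable in the product order (where $0<1$ in each coordinate); (2) $\big(\sum_{w\in\mathbb{F}_2^d}C_w\big)C_v$ for all $v$; (3) $C_vC_{v'}\sum_{w\in\mathbb{F}_2^d,\ w_i=v_i}C_w$ for all $i\in\{1,\ldots,d\}$ and $v,v'$ with $v_i\neq v'_i$. Put $\mathcal{C}(I^d)_{\mathbb{Q}}=\mathcal{C}(I^d)\otimes_{\mathbb{Z}}\mathbb{Q}$. The local degree map $\mathrm{ldeg}:\mathcal{C}^{d+1}(I^d)\to\mathbb{Z}$ (on the degree $d+1$ part, extended $\mathbb{Q}$-linearly) is the group homomorphism uniquely determined by $\mathrm{ldeg}(C_{v_0}C_{v_1}\cdots C_{v_d})=1$ for every strictly increasing chain $v_0<v_1<\cdots<v_d$ in the product order. (It is defined as the intersection-theoretic degree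 of products of components of the special fibre of the desingularization, by successively blowing up the strict transforms of the special-fibre components in lexicographic order, of $\bar L^d$, $\bar L=\mathrm{Proj}\,R[x_0,x_1,z]/(x_0x_1-\pi z^2)$, over a complete discrete valuation ring $R$ with uniformizer $\pi$ and algebraically closed residue field.) For $v\in\mathbb{F}_2^d$ put $F_v:=\sum_{w\in\mathbb{F}_2^d}(-1)^{\langle v,w\rangle}C_w$, where $\langle v,w\rangle=\sum_i v_iw_i\in\mathbb{F}_2$. *)

theory Defs
  imports "HOL-Analysis.Analysis" "HOL-Library.Z2" "HOL-Library.Poly_Mapping"
begin

section \<open>Vectors over the field with two elements\<close>

instance bit :: finite
proof
  have "x \<in> {0, 1}" for x :: bit
    by (cases x) simp_all
  then show "finite (UNIV :: bit set)"
    by (metis finite.emptyI finite.insertI finite_subset subsetI)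
qed

instantiation bit :: linorder
begin

definition less_eq_bit :: "bit \<Rightarrow> bit \<Rightarrow> bool"
  where "a \<le> b \<longleftrightarrow> a = (0 :: bit) \<or> b = 1"

definition less_bit :: "bit \<Rightarrow> bit \<Rightarrow> bool"
  where "a < b \<longleftrightarrow> a = (0 :: bit) \<and> b = 1"

instance
proof
  fix x y z :: bit
  show "x < y \<longleftrightarrow> x \<le> y \<and> \<not> y \<le> x"
    by (cases x; cases y) (simp_all add: less_eq_bit_def less_bit_def)
  show "x \<le> x"
    by (cases x) (simp_all add: less_eq_bit_def)
  show "x \<le> y \<Longrightarrow> y \<le> z \<Longrightarrow> x \<le> z"
    by (cases x; cases y; cases z) (simp_all add: less_eq_bit_def)
  show "x \<le> y \<Longrightarrow> y \<le> x \<Longrightarrow> x = y"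
    by (cases x; cases y) (simp_all add: less_eq_bit_def)
  show "x \<le> y \<or> y \<le> x"
    by (cases x; cases y) (simp_all add: less_eq_bit_def)
qed

end

text \<open>
  The order on the type \<open>bit ^ 'n\<close> is now the library's product order
  (\<open>less_eq_vec_def\<close>, \<open>less_vec_def\<close>). The index type \<open>'n\<close> stands for
  \<open>{1, \<dots>, d}\<close> with \<open>d = CARD('n) \<ge> 1\<close>.
\<close>

section \<open>The combinatorial Chow ring\<close>

text \<open>Exponent vectors are finitely supported functions into \<open>nat\<close>.\<close>

type_synonym 'v int_mpoly = "('v \<Rightarrow>\<^sub>0 nat) \<Rightarrow>\<^sub>0 int"

definition mvar :: "'v \<Rightarrow> 'v int_mpoly"
  where "mvar v = Poly_Mapping.single (Poly_Mapping.single v 1) 1"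

definition homogeneous :: "nat \<Rightarrow> 'v int_mpoly \<Rightarrow> bool"
  where "homogeneous k p \<longleftrightarrow>
    (\<forall>m \<in> Poly_Mapping.keys p. (\<Sum>v \<in> Poly_Mapping.keys m. Poly_Mapping.lookup m v) = k)"

text \<open>\<open>ideal.span S\<close> is the ideal generated by \<open>S\<close>.\<close>

global_interpretation ideal: module "(*) :: 'a::comm_ring_1 \<Rightarrow> 'a \<Rightarrow> 'a"
  by unfold_locales (simp_all add: algebra_simps)

definition chow_relations :: "(bit ^ 'n) int_mpoly set"
  where "chow_relations =
      {mvar v * mvar w | v w. \<not> v \<le> w \<and> \<not> w \<le> v}
    \<union> {(\<Sum>w\<in>UNIV. mvar w) * mvar v | v. True}
    \<union> {mvar v * mvar v' * (\<Sum>w | w $ i = v $ i. mvar w) | i v v'. v $ i \<noteq> v' $ i}"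

definition chow_eq :: "(bit ^ 'n) int_mpoly \<Rightarrow> (bit ^ 'n) int_mpoly \<Rightarrow> bool"
  where "chow_eq p q \<longleftrightarrow> p - q \<in> ideal.span chow_relations"

lemma equivp_chow_eq: "equivp chow_eq"
proof (rule equivpI)
  show "reflp chow_eq"
    by (auto intro!: reflpI simp: chow_eq_def ideal.span_zero)
  show "symp chow_eq"
    by (rule sympI) (metis chow_eq_def ideal.span_neg minus_diff_eq)
  show "transp chow_eq"
  proof (rule transpI)
    fix p q r
    assume "chow_eq p q" "chow_eq q r"
    then have "(p - q) + (q - r) \<in> ideal.span chow_relations"
      unfolding chow_eq_def by (rule ideal.span_add)
    then show "chow_eq p r"
      by (simp add: chow_eq_def)
  qed
qed

lemma chow_eq_refl [intro]: "p = q \<Longrightarrow> chow_eq p q"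
  by (simp add: chow_eq_def ideal.span_zero)

quotient_type 'n chow = "(bit ^ 'n) int_mpoly" / chow_eq
  by (rule equivp_chow_eq)

lemma zero_notin_keys_chow_ideal:
  assumes "p \<in> ideal.span (chow_relations :: (bit ^ 'n) int_mpoly set)"
  shows "0 \<notin> Poly_Mapping.keys p"
proof -
  have mult: "0 \<notin> Poly_Mapping.keys (q * r)" if "0 \<notin> Poly_Mapping.keys r"
    for q r :: "(bit ^ 'n) int_mpoly"
  proof
    assume "0 \<in> Poly_Mapping.keys (q * r)"
    then obtain a b where ab: "0 = a + b" "b \<in> Poly_Mapping.keys r"
      using keys_mult[of q r] by auto
    have "Poly_Mapping.lookup b x = 0" for x
      using arg_cong[OF ab(1), of "\<lambda>m. Poly_Mapping.lookup m x"] by (simp add: lookup_add)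
    then have "b = 0"
      by (auto intro: poly_mapping_eqI)
    with ab(2) that show False by simp
  qed
  have mvar: "0 \<notin> Poly_Mapping.keys (mvar v)" for v :: "bit ^ 'n"
    by (metis keys_single mvar_def one_neq_zero singletonD single_zero lookup_single_eq)
  have sum: "0 \<notin> Poly_Mapping.keys (sum mvar A)" for A :: "(bit ^ 'n) set"
    using mvar by (auto simp: in_keys_iff lookup_sum)
  have gen: "0 \<notin> Poly_Mapping.keys r"
    if "r \<in> (chow_relations :: (bit ^ 'n) int_mpoly set)" for r
    using that unfolding chow_relations_def
    by (auto dest: mult[OF mvar, THEN notE] mult[OF sum, THEN notE])
  show ?thesis
    using assms
  proof (induction rule: ideal.span_induct_alt)
    case base
    show ?case by simp
  next
    case (step c x y)
    then show ?case
      using mult[OF gen, of x c] by (auto simp: in_keys_iff lookup_add)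
  qed
qed

instantiation chow :: (finite) comm_ring_1
begin

lift_definition zero_chow :: "'a chow" is 0 .

lift_definition one_chow :: "'a chow" is 1 .

lift_definition plus_chow :: "'a chow \<Rightarrow> 'a chow \<Rightarrow> 'a chow" is "(+)"
  unfolding chow_eq_def add_diff_add by (rule ideal.span_add)

lift_definition uminus_chow :: "'a chow \<Rightarrow> 'a chow" is uminus
  unfolding chow_eq_def minus_diff_minus by (rule ideal.span_neg)

lift_definition minus_chow :: "'a chow \<Rightarrow> 'a chow \<Rightarrow> 'a chow" is "(-)"
  unfolding chow_eq_def by (drule (1) ideal.span_diff) (simp only: diff_diff_eq2 diff_diff_eq add.commute add.left_commute add_diff_eq diff_add_eq)

lift_definition times_chow :: "'a chow \<Rightarrow> 'a chow \<Rightarrow> 'a chow" is "(*)"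
proof -
  fix a a' b b' :: "(bit ^ 'a) int_mpoly"
  assume "chow_eq a a'" "chow_eq b b'"
  then have "b * (a - a') + a' * (b - b') \<in> ideal.span chow_relations"
    unfolding chow_eq_def by (intro ideal.span_add ideal.span_scale)
  also have "b * (a - a') + a' * (b - b') = a * b - a' * b'"
    by (simp add: algebra_simps)
  finally show "chow_eq (a * b) (a' * b')"
    by (simp add: chow_eq_def)
qed

instance
proof
  fix a b c :: "'a chow"
  show "a * b * c = a * (b * c)"
    by (transfer, rule chow_eq_refl, rule mult.assoc)
  show "a * b = b * a"
    by (transfer, rule chow_eq_refl, rule mult.commute)
  show "1 * a = a"
    by (transfer, rule chow_eq_refl, rule mult_1)
  show "a + b + c = a + (b + c)"
    by (transfer, rule chow_eq_refl, rule add.assoc)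
  show "a + b = b + a"
    by (transfer, rule chow_eq_refl, rule add.commute)
  show "0 + a = a"
    by (transfer, rule chow_eq_refl, rule add_0)
  show "- a + a = 0"
    by (transfer, rule chow_eq_refl, rule left_minus)
  show "a - b = a + - b"
    by (transfer, rule chow_eq_refl, rule diff_conv_add_uminus)
  show "(a + b) * c = a * c + b * c"
    by (transfer, rule chow_eq_refl, rule distrib_right)
  show "(0 :: 'a chow) \<noteq> 1"
  proof (transfer, unfold chow_eq_def, rule notI)
    assume "0 - 1 \<in> ideal.span (chow_relations :: (bit ^ 'a) int_mpoly set)"
    from zero_notin_keys_chow_ideal[OF this] show False
      by (simp add: in_keys_iff lookup_minus lookup_one)
  qed
qed

end

lift_definition C :: "bit ^ 'n \<Rightarrow> 'n::finite chow" is mvar .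

definition chow_graded :: "nat \<Rightarrow> 'n::finite chow set"
  where "chow_graded k = {abs_chow p | p. homogeneous k p}"

section \<open>The tensor product of commutative rings over the integers\<close>

text \<open>
  The tensor product is the free abelian group on pairs modulo the subgroup generated by the
  biadditivity relations; \<open>frag.span S\<close> is the subgroup generated by \<open>S\<close>.
\<close>

global_interpretation frag: module "frag_cmul :: int \<Rightarrow> ('a \<Rightarrow>\<^sub>0 int) \<Rightarrow> ('a \<Rightarrow>\<^sub>0 int)"
  by unfold_locales (simp_all add: frag_cmul_distrib frag_cmul_distrib2)

definition tensor_relations :: "('a::comm_ring_1 \<times> 'b::comm_ring_1 \<Rightarrow>\<^sub>0 int) set"
  where "tensor_relations =
      {frag_of (a + a', b) - frag_of (a, b) - frag_of (a', b) | a a' b. True}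
    \<union> {frag_of (a, b + b') - frag_of (a, b) - frag_of (a, b') | a b b'. True}"

definition tensor_eq ::
    "('a::comm_ring_1 \<times> 'b::comm_ring_1 \<Rightarrow>\<^sub>0 int) \<Rightarrow> ('a \<times> 'b \<Rightarrow>\<^sub>0 int) \<Rightarrow> bool"
  where "tensor_eq f g \<longleftrightarrow> f - g \<in> frag.span tensor_relations"

lemma equivp_tensor_eq: "equivp tensor_eq"
proof (rule equivpI)
  show "reflp tensor_eq"
    by (auto intro!: reflpI simp: tensor_eq_def frag.span_zero)
  show "symp tensor_eq"
    by (rule sympI) (metis tensor_eq_def frag.span_neg minus_diff_eq)
  show "transp tensor_eq"
  proof (rule transpI)
    fix p q r
    assume "tensor_eq p q" "tensor_eq q r"
    then have "(p - q) + (q - r) \<in> frag.span tensor_relations"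
      unfolding tensor_eq_def by (rule frag.span_add)
    then show "tensor_eq p r"
      by (simp add: tensor_eq_def)
  qed
qed

lemma tensor_eq_refl [intro]: "p = q \<Longrightarrow> tensor_eq p q"
  by (simp add: tensor_eq_def frag.span_zero)

quotient_type (overloaded) ('a, 'b) tensor = "'a::comm_ring_1 \<times> 'b::comm_ring_1 \<Rightarrow>\<^sub>0 int" / tensor_eq
  by (rule equivp_tensor_eq)

text \<open>The biadditive extension of \<open>(a, b) \<cdot> (a', b') = (a a', b b')\<close>.\<close>

definition frag_mult ::
    "('a::comm_ring_1 \<times> 'b::comm_ring_1 \<Rightarrow>\<^sub>0 int) \<Rightarrow> ('a \<times> 'b \<Rightarrow>\<^sub>0 int) \<Rightarrow> ('a \<times> 'b \<Rightarrow>\<^sub>0 int)"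
  where "frag_mult f g =
    frag_extend (\<lambda>x. frag_extend (\<lambda>y. frag_of (fst x * fst y, snd x * snd y)) g) f"

lemma frag_mult_0_left [simp]: "frag_mult 0 g = 0"
  by (simp add: frag_mult_def)

lemma frag_mult_diff_left: "frag_mult (f - f') g = frag_mult f g - frag_mult f' g"
  by (simp add: frag_mult_def frag_extend_diff)

lemma frag_mult_add_left: "frag_mult (f + f') g = frag_mult f g + frag_mult f' g"
  by (simp add: frag_mult_def frag_extend_add)

lemma frag_mult_cmul_left: "frag_mult (frag_cmul c f) g = frag_cmul c (frag_mult f g)"
  by (simp add: frag_mult_def frag_extend_cmul)

lemma frag_mult_of_of:
  "frag_mult (frag_of x) (frag_of y) = frag_of (fst x * fst y, snd x * snd y)"
  by (simp add: frag_mult_def)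

lemma frag_mult_of_diff:
  "frag_mult (frag_of x) (g - g') = frag_mult (frag_of x) g - frag_mult (frag_of x) g'"
  by (simp add: frag_mult_def frag_extend_diff)

lemma frag_mult_0_right [simp]: "frag_mult f 0 = 0"
  by (simp add: frag_mult_def frag_extend_eq_0)

lemmas frag_induct_UNIV = frag_induction[OF subset_UNIV, case_names zero single diff]

lemma frag_mult_diff_right: "frag_mult f (g - g') = frag_mult f g - frag_mult f g'"
proof (induction f rule: frag_induct_UNIV)
  case (diff a b)
  then show ?case by (simp add: frag_mult_diff_left)
qed (simp_all add: frag_mult_of_diff)

lemma frag_mult_commute: "frag_mult f g = frag_mult g f"
proof (induction f rule: frag_induct_UNIV)
  case (single x)
  show ?case
  proof (induction g rule: frag_induct_UNIV)
    case (single y)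
    show ?case by (simp only: frag_mult_of_of mult.commute)
  qed (simp_all add: frag_mult_diff_left frag_mult_diff_right)
qed (simp_all add: frag_mult_diff_left frag_mult_diff_right)

lemma frag_mult_assoc: "frag_mult (frag_mult f g) h = frag_mult f (frag_mult g h)"
proof (induction f rule: frag_induct_UNIV)
  case (single x)
  show ?case
  proof (induction g rule: frag_induct_UNIV)
    case (single y)
    show ?case
    proof (induction h rule: frag_induct_UNIV)
      case (single z)
      show ?case by (simp only: frag_mult_of_of fst_conv snd_conv mult.assoc)
    qed (simp_all add: frag_mult_diff_left frag_mult_diff_right)
  qed (simp_all add: frag_mult_diff_left frag_mult_diff_right)
qed (simp_all add: frag_mult_diff_left frag_mult_diff_right)

lemma frag_mult_1: "frag_mult (frag_of (1, 1)) f = f"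
proof (induction f rule: frag_induct_UNIV)
  case (single x)
  show ?case by (simp only: frag_mult_of_of fst_conv snd_conv mult_1 prod.collapse)
qed (simp_all add: frag_mult_diff_right)

lemma frag_mult_span:
  assumes "f \<in> frag.span tensor_relations"
  shows "frag_mult f g \<in> frag.span tensor_relations"
proof -
  have gen: "frag_mult r g \<in> frag.span tensor_relations" if r: "r \<in> tensor_relations" for r
  proof (induction g rule: frag_induct_UNIV)
    case (single y)
    obtain c d where y: "y = (c, d)" by (cases y)
    have "frag_mult r (frag_of y) \<in> tensor_relations"
      using r unfolding tensor_relations_def y
      by (auto simp: frag_mult_diff_left frag_mult_of_of distrib_right) blast+
    then show ?case by (rule frag.span_base)
  qed (simp_all add: frag.span_zero frag_mult_diff_right frag.span_diff)
  show ?thesis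
    using assms
  proof (induction rule: frag.span_induct_alt)
    case base
    show ?case by (simp add: frag.span_zero)
  next
    case (step c x y)
    then show ?case
      by (simp add: frag_mult_add_left frag_mult_cmul_left frag.span_add frag.span_scale gen)
  qed
qed

text \<open>
  A tensor product of nonzero rings can be the zero ring, so the class \<open>comm_ring_1\<close>, which
  contains \<open>0 \<noteq> 1\<close>, is not available in general.
\<close>

instantiation tensor :: (comm_ring_1, comm_ring_1) "{comm_ring, comm_monoid_mult}"
begin

lift_definition zero_tensor :: "('a, 'b) tensor" is 0 .

lift_definition one_tensor :: "('a, 'b) tensor" is "frag_of (1, 1)" .

lift_definition plus_tensor :: "('a, 'b) tensor \<Rightarrow> ('a, 'b) tensor \<Rightarrow> ('a, 'b) tensor" is "(+)"
  unfolding tensor_eq_def add_diff_add by (rule frag.span_add)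

lift_definition uminus_tensor :: "('a, 'b) tensor \<Rightarrow> ('a, 'b) tensor" is uminus
  unfolding tensor_eq_def minus_diff_minus by (rule frag.span_neg)

lift_definition minus_tensor :: "('a, 'b) tensor \<Rightarrow> ('a, 'b) tensor \<Rightarrow> ('a, 'b) tensor" is "(-)"
  unfolding tensor_eq_def by (drule (1) frag.span_diff) (simp only: diff_diff_eq2 diff_diff_eq add.commute add.left_commute add_diff_eq diff_add_eq)

lift_definition times_tensor :: "('a, 'b) tensor \<Rightarrow> ('a, 'b) tensor \<Rightarrow> ('a, 'b) tensor"
  is frag_mult
proof -
  fix f f' g g' :: "'a \<times> 'b \<Rightarrow>\<^sub>0 int"
  assume "tensor_eq f f'" "tensor_eq g g'"
  then have "frag_mult (f - f') g + frag_mult (g - g') f' \<in> frag.span tensor_relations"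
    unfolding tensor_eq_def by (intro frag.span_add frag_mult_span)
  also have "frag_mult (f - f') g + frag_mult (g - g') f' = frag_mult f g - frag_mult f' g'"
    by (simp add: frag_mult_diff_left frag_mult_diff_right frag_mult_commute[of g] frag_mult_commute[of g'])
  finally show "tensor_eq (frag_mult f g) (frag_mult f' g')"
    by (simp add: tensor_eq_def)
qed

instance
proof
  fix a b c :: "('a, 'b) tensor"
  show "a + b + c = a + (b + c)" "a + b = b + a" "0 + a = a" "- a + a = 0" "a - b = a + - b"
    by (transfer, rule tensor_eq_refl, simp add: add.assoc add.commute)+
  show "a * b * c = a * (b * c)" "1 * a = a" "(a + b) * c = a * c + b * c"
    by (transfer, rule tensor_eq_refl,
        simp add: frag_mult_assoc frag_mult_1 frag_mult_add_left)+
  show "a * b = b * a"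
    by (transfer, rule tensor_eq_refl, rule frag_mult_commute)
qed

end

lift_definition tens :: "'a::comm_ring_1 \<Rightarrow> 'b::comm_ring_1 \<Rightarrow> ('a, 'b) tensor"
  is "\<lambda>a b. frag_of (a, b)" .

type_synonym 'n chow_rat = "('n chow, rat) tensor"

text \<open>The image of the degree \<open>k\<close> part tensored with the rationals.\<close>

definition chow_rat_graded :: "nat \<Rightarrow> 'n::finite chow_rat set"
  where "chow_rat_graded k =
    {\<Sum>i<m. tens (x i) (q i) | (m :: nat) x q. \<forall>i<m. x i \<in> chow_graded k}"

section \<open>The local degree\<close>

text \<open>
  Maps on a graded piece are total functions with the value \<open>undefined\<close> elsewhere
  (\<open>extensional\<close>), so that the descriptions by \<open>THE\<close> below determine them. A strictly increasing chain
  \<open>v\<^sub>0 < \<dots> < v\<^sub>d\<close> is a function on \<open>nat\<close> of which only the values at \<open>0, \<dots>, d\<close> are used.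
\<close>

definition is_ldeg :: "('n::finite chow \<Rightarrow> int) \<Rightarrow> bool"
  where "is_ldeg f \<longleftrightarrow>
      f \<in> extensional (chow_graded (CARD('n) + 1))
    \<and> (\<forall>x \<in> chow_graded (CARD('n) + 1). \<forall>y \<in> chow_graded (CARD('n) + 1). f (x + y) = f x + f y)
    \<and> (\<forall>v :: nat \<Rightarrow> bit ^ 'n. (\<forall>i < CARD('n). v i < v (Suc i)) \<longrightarrow> f (\<Prod>i\<le>CARD('n). C (v i)) = 1)"

definition ldeg_int :: "'n::finite chow \<Rightarrow> int"
  where "ldeg_int = (THE f. is_ldeg f)"

text \<open>Multiplication by \<open>tens 1 q\<close> is the scalar multiplication by the rational number \<open>q\<close>.\<close>

definition is_ldeg_extension :: "('n::finite chow_rat \<Rightarrow> rat) \<Rightarrow> bool"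
  where "is_ldeg_extension g \<longleftrightarrow>
      g \<in> extensional (chow_rat_graded (CARD('n) + 1))
    \<and> (\<forall>x \<in> chow_rat_graded (CARD('n) + 1). \<forall>y \<in> chow_rat_graded (CARD('n) + 1).
          g (x + y) = g x + g y)
    \<and> (\<forall>q. \<forall>x \<in> chow_rat_graded (CARD('n) + 1). g (tens 1 q * x) = q * g x)
    \<and> (\<forall>x \<in> chow_graded (CARD('n) + 1). g (tens x 1) = of_int (ldeg_int x))"

definition ldeg :: "'n::finite chow_rat \<Rightarrow> rat"
  where "ldeg = (THE g. is_ldeg_extension g)"

section \<open>The elements \<open>F\<close> and the group action\<close>

definition dot :: "bit ^ 'n \<Rightarrow> bit ^ 'n \<Rightarrow> bit"
  where "dot v w = (\<Sum>i\<in>UNIV. v $ i * w $ i)"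

definition F :: "bit ^ 'n \<Rightarrow> 'n::finite chow"
  where "F v = (\<Sum>w\<in>UNIV. if dot v w = 0 then C w else - C w)"

text \<open>The image of \<open>F v\<close> in the rational Chow ring.\<close>

definition F_rat :: "bit ^ 'n \<Rightarrow> 'n::finite chow_rat"
  where "F_rat v = tens (F v) 1"

abbreviation digits :: "bit \<Rightarrow> bit \<Rightarrow> bit \<Rightarrow> bit ^ 3"
  where "digits a b c \<equiv> vector [a, b, c]"

text \<open>The linear map that sends the basis vector \<open>e\<^sub>i\<close> to \<open>e\<^sub>\<tau>\<^sub>(\<^sub>i\<^sub>)\<close>.\<close>

definition permute_basis :: "('n \<Rightarrow> 'n) \<Rightarrow> bit ^ 'n \<Rightarrow> bit ^ 'n::finite"
  where "permute_basis \<tau> v = (\<chi> i. v $ inv \<tau> i)"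

text \<open>Quadruples are lists of length 4, indexed from 0.\<close>

definition act :: "(nat \<Rightarrow> nat) \<Rightarrow> (3 \<Rightarrow> 3) \<Rightarrow> (bit ^ 3) list \<Rightarrow> (bit ^ 3) list"
  where "act \<sigma> \<tau> V = map (\<lambda>k. permute_basis \<tau> (V ! \<sigma> k)) [0, 1, 2, 3]"

definition in_orbit :: "(bit ^ 3) list \<Rightarrow> (bit ^ 3) list \<Rightarrow> bool"
  where "in_orbit V W \<longleftrightarrow>
    (\<exists>\<sigma> \<tau>. \<sigma> permutes {0, 1, 2, 3} \<and> \<tau> permutes UNIV \<and> V = act \<sigma> \<tau> W)"

end

theory Submission
  imports Defs
begin

text \<open>
  The degree of a monomial supported on a chain has a closed form, a signed product of binomial
  coefficients in the multiplicities and the gaps of the chain. For \<open>d = 3\<close> it is a finite check that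
  this form is compatible with the relations. Uniqueness holds for every \<open>d\<close>: relation (3) trades
  one copy of a repeated vertex of a chain for monomials with larger support or with a repeated
  vertex higher up in the same chain, so the strictly increasing chains span the top degree.
  By multilinearity, the degrees of the products of four \<open>F v\<close> are the Walsh-Hadamard transform,
  in \<open>4 \<sqdot> 3 = 12\<close> bits, of the degrees of the products of four \<open>C w\<close>.
\<close>

text \<open>Both \<open>ldeg_int\<close> and \<open>ldeg\<close> are definite descriptions, so a
  value can be computed only after existence and uniqueness are settled. For existence, an additive
  map on polynomials must kill every multiple of every relation, in all degrees. The closed form
  vanishes outside degree 4, so only multiples by monomials of complementary degree remain: two
  variables for relation (2), one for relation (3). Relation (1) is built in, as the form is zero
  off chains. The orbit conditions quantify over permutations. The action of S_4 amounts to equality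
  of multisets and that of S_3 to six coordinate permutations, so membership becomes a lookup of a
  sorted list of binary codes.\<close>

section \<open>Degrees of monomials\<close>

text \<open>
  The list contains the multiplicities by weight. A vertex of multiplicity \<open>Suc e\<close> distributes its
  excess \<open>e\<close> over the adjacent gaps, and every gap of \<open>z\<close> missing weights must receive exactly \<open>z\<close>:
  \<open>r\<close> from the vertex before it and hence \<open>z - r\<close> from the vertex after it. If \<open>r > z\<close>, the
  subtraction is truncated, but then \<open>z choose r = 0\<close>.
\<close>

fun chain_deg :: "nat \<Rightarrow> nat \<Rightarrow> nat list \<Rightarrow> int"
  where "chain_deg z r [] = (if z = r then 1 else 0)"
  | "chain_deg z r (0 # xs) = chain_deg (Suc z) r xs"
  | "chain_deg z r (Suc e # xs) =
      (-1) ^ e * int (z choose r) * int (e choose (z - r)) * chain_deg 0 (e - (z - r)) xs"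

text \<open>All excess goes into gaps and every gap is filled, so the total multiplicity equals the
  number of weights. The open gap \<open>z\<close> and the excess \<open>r\<close> already promised
  to it correct the count at an intermediate state. Nonzero binomials exclude truncated
  subtraction.\<close>

lemma chain_deg_sum_list:
  "chain_deg z r xs \<noteq> 0 \<Longrightarrow> r + sum_list xs = z + length xs"
proof (induction z r xs rule: chain_deg.induct)
  case (3 z r e xs)
  then have "r \<le> z" "z - r \<le> e" "e - (z - r) + sum_list xs = length xs"
    by (auto simp: not_less[symmetric])
  then show ?case by simp
qed (auto split: if_splits)

definition weight :: "bit ^ 'n \<Rightarrow> nat"
  where "weight v = card {i. v $ i = 1}"

lemma weight_le: "weight (v :: bit ^ 'n) \<le> CARD('n)"
  unfolding weight_def by (rule card_mono) auto

lemma weight_strict_mono: "weight v < weight w" if "v < w" for v w :: "bit ^ 'n"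
proof -
  have le: "v \<le> w" and "\<not> w \<le> v"
    using that by (simp_all add: less_le_not_le)
  then obtain i where "\<not> w $ i \<le> v $ i"
    by (auto simp: less_eq_vec_def)
  then have i: "v $ i < w $ i"
    by simp
  have "{i. v $ i = 1} \<subset> {i. w $ i = 1}"
  proof
    show "{i. v $ i = 1} \<subseteq> {i. w $ i = 1}"
      using le unfolding less_eq_vec_def less_eq_bit_def by (auto dest: spec)
        (metis zero_neq_one)
    show "{i. v $ i = 1} \<noteq> {i. w $ i = 1}"
      using i unfolding less_bit_def by (metis (mono_tags) mem_Collect_eq zero_neq_one)
  qed
  then show ?thesis
    unfolding weight_def by (intro psubset_card_mono) auto
qed

definition chain :: "'a::order set \<Rightarrow> bool"
  where "chain S \<longleftrightarrow> (\<forall>v\<in>S. \<forall>w\<in>S. v \<le> w \<or> w \<le> v)"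

lemma weight_inj_on_chain: "chain S \<Longrightarrow> inj_on weight S" for S :: "(bit ^ 'n) set"
  unfolding chain_def inj_on_def
  by (metis order_less_irrefl order_le_less weight_strict_mono)

text \<open>On a chain the weight identifies the vertex, so multiplicities by weight lose nothing.
  The value 0 off chains is forced by relation (1).\<close>

definition list_deg :: "(bit ^ 'n) list \<Rightarrow> int"
  where "list_deg xs = (if chain (set xs)
    then chain_deg 0 0 (map (\<lambda>r. length (filter (\<lambda>v. weight v = r) xs)) [0..<Suc CARD('n)]) else 0)"

lemma list_deg_mset: "mset xs = mset ys \<Longrightarrow> list_deg xs = list_deg ys"
proof -
  assume eq: "mset xs = mset ys"
  then have "length (filter P xs) = length (filter P ys)" for P
    by (metis mset_filter size_mset)
  moreover have "set xs = set ys"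
    using eq by (rule mset_eq_setD)
  ultimately show ?thesis
    by (simp add: list_deg_def)
qed

lemma list_deg_length:
  fixes xs :: "(bit ^ 'n) list"
  assumes "list_deg xs \<noteq> 0"
  shows "length xs = Suc CARD('n)"
proof -
  have "sum_list (map (\<lambda>r. length (filter (\<lambda>v. weight v = r) ys)) [0..<Suc CARD('n)]) = length ys"
    for ys :: "(bit ^ 'n) list"
  proof (induction ys)
    case (Cons y ys)
    have "sum_list (map (\<lambda>r. length (filter (\<lambda>v. weight v = r) (y # ys))) [0..<Suc CARD('n)])
      = (\<Sum>r<Suc CARD('n). length (filter (\<lambda>v. weight v = r) ys) + (if r = weight y then 1 else 0))"
      by (simp only: interv_sum_list_conv_sum_set_nat set_upt atLeast0LessThan) (rule sum.cong, auto)
    also have "\<dots> = Suc (length ys)"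
      using Cons.IH weight_le[of y]
      by (simp only: interv_sum_list_conv_sum_set_nat set_upt atLeast0LessThan sum.distrib) auto
    finally show ?case by simp
  qed simp
  then show ?thesis
    using chain_deg_sum_list[of 0 0] assms by (force simp add: list_deg_def split: if_splits)
qed

section \<open>Words as monomials, and additive extension from a basis\<close>

definition monomial :: "'v list \<Rightarrow> 'v \<Rightarrow>\<^sub>0 nat"
  where "monomial xs = (\<Sum>v\<leftarrow>xs. Poly_Mapping.single v 1)"

lemma monomial_simps [simp]:
  "monomial [] = 0"
  "monomial (x # xs) = Poly_Mapping.single x 1 + monomial xs"
  by (simp_all add: monomial_def)

lemma lookup_monomial: "Poly_Mapping.lookup (monomial xs) v = count_list xs v"
  by (induction xs) (auto simp: lookup_add lookup_single when_def)

lemma monomial_surj: "\<exists>xs. m = monomial xs"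
proof (induction m rule: update_induct)
  case const
  show ?case by (rule exI[of _ "[]"]) simp
next
  case (update m v n)
  then obtain xs where m: "m = monomial xs" by blast
  have "count_list (replicate n v) w = (if v = w then n else 0)" for w
    by (induction n) auto
  then have "Poly_Mapping.update v n m = monomial (replicate n v @ xs)"
    using update.hyps(1) unfolding m
    by (intro poly_mapping_eqI)
      (auto simp: lookup_monomial lookup_update in_keys_iff)
  then show ?case ..
qed

lemma monomial_eq_iff: "monomial xs = monomial ys \<longleftrightarrow> mset xs = mset ys"
  by (auto simp: poly_mapping_eq_iff fun_eq_iff lookup_monomial multiset_eq_iff count_mset)

lemma degree_monomial:
  "(\<Sum>v\<in>Poly_Mapping.keys (monomial xs). Poly_Mapping.lookup (monomial xs) v) = length xs"
proof -
  have "Poly_Mapping.keys (monomial xs) = set xs"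
    by (auto simp: in_keys_iff lookup_monomial count_list_0_iff)
  then show ?thesis
    by (simp add: lookup_monomial sum_count_set)
qed

lemma prod_list_mvar: "prod_list (map mvar xs) = frag_of (monomial xs)"
  by (induction xs) (simp_all add: mvar_def mult_single)

text \<open>Serves two free abelian groups: polynomials, on exponent vectors, and the group on pairs
  before the tensor relations are imposed.\<close>

definition frag_eval :: "('a \<Rightarrow> 'b::comm_ring_1) \<Rightarrow> ('a \<Rightarrow>\<^sub>0 int) \<Rightarrow> 'b"
  where "frag_eval t p = (\<Sum>m\<in>Poly_Mapping.keys p. of_int (Poly_Mapping.lookup p m) * t m)"

lemma frag_eval_superset:
  assumes "finite A" "Poly_Mapping.keys p \<subseteq> A"
  shows "frag_eval t p = (\<Sum>m\<in>A. of_int (Poly_Mapping.lookup p m) * t m)"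
  unfolding frag_eval_def using assms by (intro sum.mono_neutral_left) (auto simp: in_keys_iff)

lemma frag_eval_add: "frag_eval t (p + q) = frag_eval t p + frag_eval t q"
  using Poly_Mapping.keys_add[of p q]
  by (simp add: frag_eval_superset[of "Poly_Mapping.keys p \<union> Poly_Mapping.keys q"]
      lookup_add distrib_right sum.distrib)

lemma frag_eval_0 [simp]: "frag_eval t 0 = 0"
  by (simp add: frag_eval_def)

lemma frag_eval_frag_of [simp]: "frag_eval t (frag_of m) = t m"
  by (simp add: frag_eval_def)

lemma frag_eval_diff: "frag_eval t (p - q) = frag_eval t p - frag_eval t q"
  using frag_eval_add[of t "p - q" q] by simp

lemma frag_eval_sum: "frag_eval t (\<Sum>i\<in>I. p i) = (\<Sum>i\<in>I. frag_eval t (p i))"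
  by (induction I rule: infinite_finite_induct) (simp_all add: frag_eval_add)

lemma frag_eval_cmul: "frag_eval t (frag_cmul c p) = of_int c * frag_eval t p"
  using keys_cmul[of c p]
  by (simp add: frag_eval_superset[of "Poly_Mapping.keys p"] sum_distrib_left
      mult.assoc del: ideal.scale_scale) \<comment> \<open>\<open>ideal.scale_scale\<close> is \<open>mult.assoc\<close> reversed\<close>

text \<open>Any word representing the monomial will do, since \<open>list_deg\<close> is invariant
  under reordering.\<close>

definition poly_deg :: "(bit ^ 'n) int_mpoly \<Rightarrow> int"
  where "poly_deg = frag_eval (\<lambda>m. list_deg (SOME xs. monomial xs = m))"

lemma poly_deg_sum: "poly_deg (\<Sum>i\<in>I. p i) = (\<Sum>i\<in>I. poly_deg (p i))"
  by (simp add: poly_deg_def frag_eval_sum)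

lemma poly_deg_prod_mvar: "poly_deg (prod_list (map mvar xs)) = list_deg xs"
proof -
  have "monomial (SOME ys. monomial ys = monomial xs) = monomial xs"
    by (rule someI_ex) blast
  then have "list_deg (SOME ys. monomial ys = monomial xs) = list_deg xs"
    unfolding monomial_eq_iff by (rule list_deg_mset)
  then show ?thesis
    by (simp add: poly_deg_def prod_list_mvar)
qed

lemma poly_deg_mult_eq_0:
  assumes "\<And>xs. poly_deg (prod_list (map mvar xs) * r) = 0"
  shows "poly_deg (q * r) = 0"
proof (induction q rule: frag_induct_UNIV)
  case (single m)
  then show ?case
    using assms monomial_surj[of m] by (auto simp: prod_list_mvar)
qed (simp_all add: left_diff_distrib poly_deg_def frag_eval_diff)

section \<open>Graded pieces and relations of the Chow ring\<close>

lemma prod_list_C: "prod_list (map C xs) = abs_chow (prod_list (map mvar xs))"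
  by (induction xs) (simp_all add: one_chow_def C.abs_eq times_chow.abs_eq)

lemma chow_graded_prod_C: "prod_list (map C xs) \<in> chow_graded (length xs)"
proof -
  have "homogeneous (length xs) (prod_list (map mvar xs))"
    by (simp add: homogeneous_def prod_list_mvar degree_monomial)
  then show ?thesis
    unfolding chow_graded_def prod_list_C by blast
qed

lemma chow_graded_diff:
  assumes "x \<in> chow_graded k" "y \<in> chow_graded k"
  shows "x - y \<in> chow_graded k"
proof -
  obtain p q where pq: "x = abs_chow p" "y = abs_chow q" "homogeneous k p" "homogeneous k q"
    using assms unfolding chow_graded_def by blast
  have "homogeneous k (p - q)"
    using pq(3,4) keys_diff[of p q] unfolding homogeneous_def by blast
  then show ?thesis
    unfolding chow_graded_def pq(1,2) minus_chow.abs_eq by blast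
qed

lemma chow_graded_0: "0 \<in> chow_graded k"
  unfolding chow_graded_def zero_chow_def by (auto simp: homogeneous_def)

lemma chow_graded_uminus: "x \<in> chow_graded k \<Longrightarrow> - x \<in> chow_graded k"
  using chow_graded_diff[OF chow_graded_0] by force

lemma chow_graded_add: "x \<in> chow_graded k \<Longrightarrow> y \<in> chow_graded k \<Longrightarrow> x + y \<in> chow_graded k"
  using chow_graded_diff[OF _ chow_graded_uminus] by force

lemma chow_graded_sum: "(\<And>i. i \<in> I \<Longrightarrow> x i \<in> chow_graded k) \<Longrightarrow> sum x I \<in> chow_graded k"
  by (induction I rule: infinite_finite_induct) (auto intro: chow_graded_0 chow_graded_add)

text \<open>A homogeneous polynomial involves only monomials of its degree, so the products of
  \<open>k\<close> generators span the graded piece as a group; closure under differences covers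
  sums and negatives at once.\<close>

lemma chow_graded_induct [consumes 1, case_names zero prod diff]:
  assumes x: "x \<in> chow_graded k"
    and zero: "P 0"
    and prod: "\<And>xs. length xs = k \<Longrightarrow> P (prod_list (map C xs))"
    and diff: "\<And>y z. \<lbrakk>y \<in> chow_graded k; z \<in> chow_graded k; P y; P z\<rbrakk> \<Longrightarrow> P (y - z)"
  shows "P x"
proof -
  obtain p where p: "x = abs_chow p" "homogeneous k p"
    using x unfolding chow_graded_def by blast
  have "Poly_Mapping.keys p \<subseteq> monomial ` {xs. length xs = k}"
  proof
    fix m assume m: "m \<in> Poly_Mapping.keys p"
    obtain xs where "m = monomial xs"
      using monomial_surj by blast
    then show "m \<in> monomial ` {xs. length xs = k}"
      using p(2) m degree_monomial[of xs] by (auto simp: homogeneous_def)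
  qed
  then have "abs_chow p \<in> chow_graded k \<and> P (abs_chow p)"
  proof (induction p rule: frag_induction)
    case zero
    then show ?case
      using assms(2) chow_graded_0 by (simp add: zero_chow_def)
  next
    case (one m)
    then obtain xs where "m = monomial xs" "length xs = k" by blast
    then show ?case
      using prod[of xs] chow_graded_prod_C[of xs] by (simp add: prod_list_C prod_list_mvar)
  next
    case (diff p q)
    then show ?case
      using assms(4) chow_graded_diff by (metis minus_chow.abs_eq)
  qed
  then show ?thesis
    by (simp add: p)
qed

lemma C_mult_incomparable: "C v * C w = 0" if "\<not> v \<le> w" "\<not> w \<le> v"
  using that by transfer
    (auto simp: chow_eq_def chow_relations_def intro!: ideal.span_base)

lemma sum_C_eq_abs_chow: "(\<Sum>w\<in>A. C w) = abs_chow (\<Sum>w\<in>A. mvar w)"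
  by (induction A rule: infinite_finite_induct)
    (simp_all add: zero_chow_def C.abs_eq plus_chow.abs_eq)

lemma sum_C_mult: "(\<Sum>w\<in>UNIV. C w) * C v = 0"
  unfolding sum_C_eq_abs_chow
  unfolding C.abs_eq times_chow.abs_eq zero_chow_def chow.abs_eq_iff chow_eq_def
  by (auto simp: chow_relations_def intro!: ideal.span_base)

lemma sum_facet_C_mult: "v $ i \<noteq> v' $ i \<Longrightarrow> C v * C v' * (\<Sum>w | w $ i = v $ i. C w) = 0"
  unfolding sum_C_eq_abs_chow
  unfolding C.abs_eq times_chow.abs_eq zero_chow_def chow.abs_eq_iff chow_eq_def
  unfolding diff_zero chow_relations_def by (rule ideal.span_base) blast

section \<open>Uniqueness of the local degree\<close>

lemma prod_list_map_remove1:
  "x \<in> set xs \<Longrightarrow> prod_list (map f xs) = f x * prod_list (map f (remove1 x xs))"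
  for f :: "'a \<Rightarrow> 'b::comm_monoid_mult"
  by (induction xs) (auto simp: mult.left_commute)

lemma prod_list_map_remove1_remove1:
  "\<lbrakk>x \<in> set xs; y \<in> set xs; x \<noteq> y\<rbrakk> \<Longrightarrow>
    prod_list (map f xs) = f x * f y * prod_list (map f (remove1 y (remove1 x xs)))"
  for f :: "'a \<Rightarrow> 'b::comm_monoid_mult"
  using prod_list_map_remove1[of x xs f] prod_list_map_remove1[of y "remove1 x xs" f]
  by (simp add: mult.assoc)

text \<open>The \<open>d + 1\<close> distinct weights in \<open>{0, ..., d}\<close> take every value
  once, so the inverse of \<open>weight\<close> enumerates the chain.\<close>

lemma strict_chain_enumeration:
  fixes S :: "(bit ^ 'n) set"
  assumes "chain S" "card S = Suc CARD('n)"
  obtains v where "\<And>i. i < CARD('n) \<Longrightarrow> v i < v (Suc i)" "bij_betw v {..CARD('n)} S"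
proof
  define v where "v = inv_into S weight"
  have "finite S"
    using assms(2) card.infinite by fastforce
  have inj: "inj_on weight S"
    using assms(1) by (rule weight_inj_on_chain)
  have "weight ` S = {..CARD('n)}"
    by (rule card_subset_eq) (auto simp: card_image[OF inj] assms(2) weight_le)
  then have bij: "bij_betw weight S {..CARD('n)}"
    using inj by (simp add: bij_betw_def)
  then show "bij_betw v {..CARD('n)} S"
    unfolding v_def by (rule bij_betw_inv_into)
  fix i assume "i < CARD('n)"
  then have mem: "v i \<in> S" "v (Suc i) \<in> S" and wt: "weight (v i) = i" "weight (v (Suc i)) = Suc i"
    using bij unfolding v_def by (auto intro: inv_into_into bij_betw_inv_into_right simp: bij_betw_def)
  have "\<not> v (Suc i) \<le> v i"
    using weight_strict_mono[of "v (Suc i)" "v i"] wt by (auto simp: order_le_less)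
  then show "v i < v (Suc i)"
    using assms(1) mem unfolding chain_def by (metis less_le_not_le)
qed

text \<open>To be applied to the difference of two candidate degrees. The argument runs on words,
  because the size of the support belongs to a word and not to its class in the quotient.\<close>

lemma degree_map_eq_0:
  fixes h :: "'n::finite chow \<Rightarrow> int"
  assumes add: "\<And>x y. \<lbrakk>x \<in> chow_graded (CARD('n) + 1); y \<in> chow_graded (CARD('n) + 1)\<rbrakk>
      \<Longrightarrow> h (x + y) = h x + h y"
    and chains: "\<And>v :: nat \<Rightarrow> bit ^ 'n. (\<And>i. i < CARD('n) \<Longrightarrow> v i < v (Suc i))
      \<Longrightarrow> h (\<Prod>i\<le>CARD('n). C (v i)) = 0"
    and x: "x \<in> chow_graded (CARD('n) + 1)"
  shows "h x = 0"
proof -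
  let ?d = "CARD('n)"
  define H where "H xs = h (prod_list (map C xs))" for xs :: "(bit ^ 'n) list"
  have h0: "h 0 = 0"
    using add[OF chow_graded_0 chow_graded_0] by simp
  have hsum: "h (\<Sum>i\<in>I. y i) = (\<Sum>i\<in>I. h (y i))"
    if "\<And>i. i \<in> I \<Longrightarrow> y i \<in> chow_graded (?d + 1)" for I and y :: "bit ^ 'n \<Rightarrow> 'n chow"
    using that
    by (induction I rule: infinite_finite_induct) (simp_all add: h0 add chow_graded_sum)
  have H_mset: "H xs = H ys" if "mset xs = mset ys" for xs ys
    using that unfolding H_def by (metis mset_map prod_mset_prod_list)
  have H_sum: "(\<Sum>w\<in>A. H (w # zs)) = 0"
    if "(\<Sum>w\<in>A. C w) * prod_list (map C zs) = 0" "length zs = ?d" for A zs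
  proof -
    have "(\<Sum>w\<in>A. H (w # zs)) = h (\<Sum>w\<in>A. prod_list (map C (w # zs)))"
      unfolding H_def using that(2) chow_graded_prod_C[of "_ # zs"] by (intro hsum[symmetric]) auto
    also have "\<dots> = h 0"
      using that(1) by (simp add: sum_distrib_right)
    finally show ?thesis
      by (simp add: h0)
  qed
  have H_sum_all: "(\<Sum>w\<in>UNIV. H (w # zs)) = 0" if "v \<in> set zs" "length zs = ?d" for v zs
  proof (rule H_sum[OF _ that(2)])
    have "prod_list (map C zs) = C v * prod_list (map C (remove1 v zs))"
      using that(1) by (rule prod_list_map_remove1)
    then show "(\<Sum>w\<in>UNIV. C w) * prod_list (map C zs) = 0"
      by (simp add: sum_C_mult flip: mult.assoc)
  qed
  have H_sum_facet: "(\<Sum>w | w $ i = v $ i. H (w # zs)) = 0"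
    if "v \<in> set zs" "v' \<in> set zs" "v $ i \<noteq> v' $ i" "length zs = ?d" for v v' i zs
  proof (rule H_sum[OF _ that(4)])
    have "v \<noteq> v'"
      using that(3) by auto
    then have "prod_list (map C zs) = C v * C v' * prod_list (map C (remove1 v' (remove1 v zs)))"
      using that(1,2) by (intro prod_list_map_remove1_remove1)
    then have "(\<Sum>w | w $ i = v $ i. C w) * prod_list (map C zs)
        = C v * C v' * (\<Sum>w | w $ i = v $ i. C w) * prod_list (map C (remove1 v' (remove1 v zs)))"
      by (simp only: ac_simps)
    then show "(\<Sum>w | w $ i = v $ i. C w) * prod_list (map C zs) = 0"
      using that(3) by (simp add: sum_facet_C_mult)
  qed
  have H_0: "H xs = 0" if "length xs = Suc ?d" for xs
    using that
  \<comment> \<open>Downward induction on the number of distinct vertices, which is bounded by the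
    length \<open>d + 1\<close> of the word.\<close>
  proof (induction "Suc ?d - card (set xs)" arbitrary: xs rule: less_induct)
    case less
    define S where "S = set xs"
    have fin: "finite S"
      by (simp add: S_def)
    have cardS: "card S \<le> Suc ?d"
      using card_length[of xs] less.prems by (simp add: S_def)
    have larger: "H ys = 0" if "length ys = Suc ?d" "S \<subset> set ys" for ys
    proof (rule less.hyps[OF _ that(1)])
      have "card S < card (set ys)" "card (set ys) \<le> Suc ?d"
        using that psubset_card_mono[of "set ys" S] card_length[of ys] by auto
      then show "Suc ?d - card (set ys) < Suc ?d - card (set xs)"
        unfolding S_def by linarith
    qed
    consider (antichain) v w where "v \<in> S" "w \<in> S" "\<not> v \<le> w" "\<not> w \<le> v"
      | (distinct) "chain S" "distinct xs" | (repeated) "chain S" "\<not> distinct xs"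
      unfolding chain_def by blast
    then show ?case
    proof cases
      case antichain
      then have "v \<noteq> w" by auto
      then have "prod_list (map C xs) = C v * C w * prod_list (map C (remove1 w (remove1 v xs)))"
        using antichain(1,2) unfolding S_def by (intro prod_list_map_remove1_remove1)
      then show ?thesis
        using antichain by (simp add: H_def h0 C_mult_incomparable)
    next
      case distinct
      then have "card S = Suc ?d"
        using less.prems by (simp add: S_def distinct_card)
      then obtain v where v: "\<And>i. i < ?d \<Longrightarrow> v i < v (Suc i)" "bij_betw v {..?d} S"
        using strict_chain_enumeration distinct(1) by metis
      have "prod_list (map C xs) = (\<Prod>w\<in>S. C w)"
        using distinct(2) by (simp add: S_def prod.distinct_set_conv_list)
      also have "\<dots> = (\<Prod>i\<le>?d. C (v i))"
        using v(2) by (rule prod.reindex_bij_betw[symmetric])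
      finally show ?thesis
        using chains[of v] v(1) by (simp add: H_def)
    next
      case repeated
      \<comment> \<open>If some element of \<open>S\<close> lies below \<open>v\<close>, relation (3) for a coordinate that separates \<open>v\<close> from
        the next lower element \<open>v'\<close> involves only vertices of \<open>S\<close> that are \<open>\<ge> v\<close>. If \<open>v\<close> is the minimum of
        \<open>S\<close>, relation (2) suffices.\<close>
      have H_repeated: "H (v # zs) = 0" if "length zs = ?d" "set zs = S" "v \<in> S" for v zs
        using that
      proof (induction "card {w \<in> S. v < w}" arbitrary: v rule: less_induct)
        case (less v)
        have rest: "H (w # zs) = 0" if "w \<in> S \<Longrightarrow> v < w" for w
        proof (cases "w \<in> S")
          case True
          then have "{u \<in> S. w < u} \<subset> {u \<in> S. v < u}"
            using that by auto
          then have "card {u \<in> S. w < u} < card {u \<in> S. v < u}"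
            using fin by (intro psubset_card_mono) auto
          then show ?thesis
            using less True by blast
        next
          case False
          then show ?thesis
            using less.prems by (intro larger) auto
        qed
        \<comment> \<open>Solve a relation for the term of \<open>v\<close>. Every other summand
          vanishes by \<open>rest\<close>: its vertex either lies outside \<open>S\<close> and
          enlarges the support, or lies in \<open>S\<close> above \<open>v\<close>.\<close>
        have finish: ?case if "(\<Sum>w\<in>A. H (w # zs)) = 0" "v \<in> A"
          "\<And>w. \<lbrakk>w \<in> A; w \<in> S; w \<noteq> v\<rbrakk> \<Longrightarrow> v < w" for A :: "(bit ^ 'n) set"
        proof -
          have "(\<Sum>w\<in>A. H (w # zs)) = H (v # zs) + (\<Sum>w\<in>A - {v}. H (w # zs))"
            using that(2) by (simp add: sum.remove)
          also have "(\<Sum>w\<in>A - {v}. H (w # zs)) = 0"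
            using that(3) by (intro sum.neutral) (auto intro: rest)
          finally show ?thesis
            using that(1) by simp
        qed
        show ?case
        proof (cases "\<exists>u\<in>S. u < v")
          case True
          then obtain v' where v': "v' \<in> S" "v' < v" and max: "\<And>u. \<lbrakk>u \<in> S; u < v; v' \<le> u\<rbrakk> \<Longrightarrow> u = v'"
            using finite_has_maximal[of "{u \<in> S. u < v}"] fin by auto
          obtain i where i: "v $ i \<noteq> v' $ i"
            using v'(2) by (metis less_irrefl vec_eq_iff)
          show ?thesis
          proof (rule finish[OF H_sum_facet[OF _ _ i]])
            fix w assume w: "w \<in> {w. w $ i = v $ i}" "w \<in> S" "w \<noteq> v"
            \<comment> \<open>The coordinate drops from 1 at \<open>v\<close> to 0 at
              \<open>v'\<close>, so a \<open>w\<close> with \<open>w $ i = v $ i\<close> is not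
              below \<open>v'\<close>; and by maximality of \<open>v'\<close> no element of
              \<open>S\<close> lies strictly between \<open>v'\<close> and \<open>v\<close>.\<close>
            have "v' $ i < v $ i"
              using i v'(2) by (metis less_eq_vec_def less_imp_le order_le_less)
            then have "\<not> w \<le> v'"
              using w(1) unfolding less_eq_vec_def by (metis (mono_tags) mem_Collect_eq not_le)
            then have "\<not> w < v"
              using repeated(1) v' w(2) max unfolding chain_def by blast
            then show "v < w"
              using repeated(1) less.prems w unfolding chain_def by (metis order_le_less)
          qed (use less.prems v' in auto)
        next
          case False
          then have above: "v < w" if "w \<in> S" "w \<noteq> v" for w
            using repeated(1) less.prems that unfolding chain_def by (metis order_le_less)
          show ?thesis
            by (rule finish[OF H_sum_all]) (use less.prems above in auto)
        qed
      qed
      \<comment> \<open>Only one copy of \<open>v\<close> moves to the front; the other stays in the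
        rest of the word, whose support is therefore still all of \<open>S\<close>.\<close>
      obtain as v bs cs where xs: "xs = as @ [v] @ bs @ [v] @ cs"
        using not_distinct_decomp[OF repeated(2)] by blast
      have "H xs = H (v # as @ bs @ [v] @ cs)"
        by (rule H_mset) (simp add: xs)
      also have "\<dots> = 0"
        using less.prems by (intro H_repeated) (auto simp: xs S_def)
      finally show ?thesis .
    qed
  qed
  show ?thesis
    using x
  proof (induction rule: chow_graded_induct)
    case (prod xs)
    then show ?case
      using H_0 by (simp add: H_def)
  next
    case (diff y z)
    then show ?case
      using add[OF chow_graded_diff[OF diff(1,2)] diff(2)] by simp
  qed (rule h0)
qed

lemma is_ldeg_unique:
  fixes f g :: "'n::finite chow \<Rightarrow> int"
  assumes f: "is_ldeg f" and g: "is_ldeg g"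
  shows "f = g"
proof (rule extensionalityI)
  show "f \<in> extensional (chow_graded (CARD('n) + 1))" "g \<in> extensional (chow_graded (CARD('n) + 1))"
    using assms by (simp_all add: is_ldeg_def)
  fix x :: "'n chow" assume x: "x \<in> chow_graded (CARD('n) + 1)"
  have "f x - g x = 0"
    by (rule degree_map_eq_0[OF _ _ x]) (use f g in \<open>simp_all add: is_ldeg_def\<close>)
  then show "f x = g x" by simp
qed

section \<open>Existence of the local degree in dimension 3\<close>

text \<open>Triples of truth values can be evaluated by rewriting; \<open>of_bits\<close> carries
  the results to vectors.\<close>

type_synonym bits3 = "bool \<times> bool \<times> bool"

fun of_bits :: "bits3 \<Rightarrow> bit ^ 3"
  where "of_bits (a, b, c) = digits (of_bool a) (of_bool b) (of_bool c)"

lemma of_bits_nth [simp]: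
  "of_bits v $ 1 = of_bool (fst v)"
  "of_bits v $ 2 = of_bool (fst (snd v))"
  "of_bits v $ 3 = of_bool (snd (snd v))"
  by (cases v; simp)+

lemma bij_of_bits: "bij of_bits"
proof (rule bijI)
  show "inj of_bits"
    by (rule injI) (auto simp: vec_eq_iff forall_3 prod_eq_iff of_bool_def split: if_splits)
  have "v = of_bits (v $ 1 = 1, v $ 2 = 1, v $ 3 = 1)" for v
    by (simp add: vec_eq_iff forall_3 of_bool_def)
  then show "surj of_bits"
    by blast
qed

lemma of_bits_le_iff: "of_bits v \<le> of_bits w \<longleftrightarrow>
    (fst v \<longrightarrow> fst w) \<and> (fst (snd v) \<longrightarrow> fst (snd w)) \<and> (snd (snd v) \<longrightarrow> snd (snd w))"
  by (simp add: less_eq_vec_def forall_3 less_eq_bit_def of_bool_def)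

definition bits_le :: "bits3 \<Rightarrow> bits3 \<Rightarrow> bool"
  where "bits_le v w \<longleftrightarrow> (case v of (a, b, c) \<Rightarrow> case w of (a', b', c') \<Rightarrow>
    (a \<longrightarrow> a') \<and> (b \<longrightarrow> b') \<and> (c \<longrightarrow> c'))"

definition bits_weight :: "bits3 \<Rightarrow> nat"
  where "bits_weight v = (case v of (a, b, c) \<Rightarrow>
    (if a then Suc else id) ((if b then Suc else id) (if c then Suc 0 else 0)))"

definition bits_deg :: "bits3 list \<Rightarrow> int"
  where "bits_deg xs = (if list_all (\<lambda>v. list_all (\<lambda>w. bits_le v w \<or> bits_le w v) xs) xs
    then chain_deg 0 0 (map (\<lambda>r. length (filter (\<lambda>v. bits_weight v = r) xs)) [0, 1, 2, 3])
    else 0)"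

lemma weight_of_bits: "weight (of_bits v) = bits_weight v"
proof -
  have "weight (of_bits v) = (\<Sum>i\<in>UNIV. if of_bits v $ i = 1 then 1 else 0)"
    by (simp add: weight_def sum.If_cases)
  then show ?thesis
    by (simp add: sum_3 bits_weight_def of_bool_def split: prod.split)
qed

lemma list_deg_of_bits: "list_deg (map of_bits xs) = bits_deg xs"
proof -
  have "[0..<Suc CARD(3)] = [0, 1, 2, 3]"
    by (simp add: upt_rec)
  then show ?thesis
    by (auto simp: list_deg_def bits_deg_def chain_def list_all_iff of_bits_le_iff bits_le_def
        filter_map o_def weight_of_bits split_beta)
qed

definition cube :: "bits3 list"
  where "cube = [(False, False, False), (False, False, True), (False, True, False),
    (False, True, True), (True, False, False), (True, False, True), (True, True, False),
    (True, True, True)]"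

lemma set_cube: "set cube = UNIV"
  by (auto simp: cube_def)

lemma distinct_cube: "distinct cube"
  by (simp add: cube_def)

lemma sum_of_bits: "(\<Sum>w | P w. f w) = (\<Sum>w\<leftarrow>filter (\<lambda>w. P (of_bits w)) cube. f (of_bits w))"
  for f :: "bit ^ 3 \<Rightarrow> 'a::comm_monoid_add"
proof -
  have "bij_betw of_bits {w. P (of_bits w)} {w. P w}"
    using bij_of_bits by (auto simp: bij_def bij_betw_def inj_on_def)
  then have "(\<Sum>w | P w. f w) = (\<Sum>w | P (of_bits w). f (of_bits w))"
    by (rule sum.reindex_bij_betw[symmetric])
  also have "{w. P (of_bits w)} = set (filter (\<lambda>w. P (of_bits w)) cube)"
    by (simp add: set_cube)
  finally show ?thesis
    using distinct_cube by (simp only: sum_list_distinct_conv_sum_set distinct_filter)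
qed

lemmas sum_UNIV_of_bits = sum_of_bits[where P = "\<lambda>_. True", simplified]

lemma bits_deg_sum:
  "list_all (\<lambda>v. list_all (\<lambda>a. list_all (\<lambda>b. (\<Sum>w\<leftarrow>cube. bits_deg [w, v, a, b]) = 0) cube) cube) cube"
  by code_simp

text \<open>The three projections play the role of the coordinate \<open>i\<close>.\<close>

lemma bits_deg_sum_facet:
  "list_all (\<lambda>i. list_all (\<lambda>v. list_all (\<lambda>v'. i v \<noteq> i v' \<longrightarrow> list_all (\<lambda>a.
      (\<Sum>w\<leftarrow>filter (\<lambda>w. i w = i v) cube. bits_deg [w, v, v', a]) = 0) cube) cube) cube)
    [\<lambda>v. fst v, \<lambda>v. fst (snd v), \<lambda>v. snd (snd v)]"
  by code_simp

text \<open>Unless \<open>ys\<close> has length 2, every summand is zero for degree reasons, which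
  extends the finite check to arbitrary words.\<close>

lemma list_deg_sum: "(\<Sum>w\<in>UNIV. list_deg (w # v # ys)) = 0" for v :: "bit ^ 3"
proof (cases "length ys = 2")
  case True
  then obtain a b where ys: "ys = [a, b]"
    by (auto simp: length_Suc_conv numeral_2_eq_2)
  obtain v' a' b' where "v = of_bits v'" "a = of_bits a'" "b = of_bits b'"
    using bij_of_bits by (metis bij_pointE)
  moreover have "(\<Sum>w\<leftarrow>cube. bits_deg [w, v', a', b']) = 0"
    using bits_deg_sum unfolding list_all_iff set_cube by blast
  ultimately show ?thesis
    using list_deg_of_bits[of "[_, v', a', b']"] by (simp add: ys sum_UNIV_of_bits)
next
  case False
  then have "list_deg (w # v # ys) = 0" for w
    using list_deg_length[of "w # v # ys"] by force
  then show ?thesis by simp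
qed

lemma list_deg_sum_facet: "(\<Sum>w | w $ i = v $ i. list_deg (w # v # v' # ys)) = 0"
  if "v $ i \<noteq> v' $ i" for v v' :: "bit ^ 3"
proof (cases "length ys = 1")
  case True
  then obtain a where ys: "ys = [a]"
    by (auto simp: length_Suc_conv)
  obtain u u' a' where uv: "v = of_bits u" "v' = of_bits u'" "a = of_bits a'"
    using bij_of_bits by (metis bij_pointE)
  obtain j where j: "j \<in> set [\<lambda>v. fst v, \<lambda>v. fst (snd v), \<lambda>v. snd (snd v)]"
    "\<And>w. of_bits w $ i = of_bool (j w)"
    using exhaust_3[of i] by (metis list.set_intros of_bits_nth)
  have "\<forall>v\<in>set cube. \<forall>v'\<in>set cube. j v \<noteq> j v' \<longrightarrow>
      (\<forall>a\<in>set cube. (\<Sum>w\<leftarrow>filter (\<lambda>w. j w = j v) cube. bits_deg [w, v, v', a]) = 0)"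
    using bits_deg_sum_facet j(1) unfolding list_all_iff by (rule bspec)
  moreover have "j u \<noteq> j u'"
    using that by (auto simp: uv j(2))
  ultimately have "(\<Sum>w\<leftarrow>filter (\<lambda>w. j w = j u) cube. bits_deg [w, u, u', a']) = 0"
    unfolding set_cube by blast
  then show ?thesis
    using list_deg_of_bits[of "[_, u, u', a']"] by (auto simp add: ys sum_of_bits uv j(2))
next
  case False
  then have "list_deg (w # v # v' # ys) = 0" for w
    using list_deg_length[of "w # v # v' # ys"] by force
  then show ?thesis by simp
qed

text \<open>\<open>poly_deg\<close> is additive but not linear over the polynomial ring, so each
  generator of the ideal is tested against every monomial.\<close>

lemma poly_deg_relation:
  assumes "r \<in> (chow_relations :: (bit ^ 3) int_mpoly set)"
  shows "poly_deg (prod_list (map mvar ys) * r) = 0"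
proof -
  consider (incomparable) v w where "r = mvar v * mvar w" "\<not> v \<le> w" "\<not> w \<le> v"
    | (sum) v where "r = (\<Sum>w\<in>UNIV. mvar w) * mvar v"
    | (facet) v v' i where "r = mvar v * mvar v' * (\<Sum>w | w $ i = v $ i. mvar w)" "v $ i \<noteq> v' $ i"
    using assms unfolding chow_relations_def by blast
  then show ?thesis
  proof cases
    case incomparable
    have "prod_list (map mvar ys) * r = prod_list (map mvar (v # w # ys))"
      by (simp only: incomparable(1) list.map prod_list.Cons ac_simps)
    moreover have "list_deg (v # w # ys) = 0"
      using incomparable(2,3) by (simp add: list_deg_def chain_def)
    ultimately show ?thesis
      by (simp only: poly_deg_prod_mvar)
  next
    case sum
    have "prod_list (map mvar ys) * r = (\<Sum>w\<in>UNIV. prod_list (map mvar (w # v # ys)))"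
      unfolding sum sum_distrib_left sum_distrib_right list.map prod_list.Cons
      by (rule sum.cong) (simp_all only: ac_simps)
    then show ?thesis
      by (simp only: poly_deg_sum poly_deg_prod_mvar list_deg_sum)
  next
    case facet
    have "prod_list (map mvar ys) * r = (\<Sum>w | w $ i = v $ i. prod_list (map mvar (w # v # v' # ys)))"
      unfolding facet(1) sum_distrib_left list.map prod_list.Cons
      by (rule sum.cong) (simp_all only: ac_simps)
    then show ?thesis
      by (simp only: poly_deg_sum poly_deg_prod_mvar list_deg_sum_facet[OF facet(2)])
  qed
qed

lemma poly_deg_span: "p \<in> ideal.span (chow_relations :: (bit ^ 3) int_mpoly set) \<Longrightarrow> poly_deg p = 0"
proof (induction rule: ideal.span_induct_alt)
  case (step q r p)
  then show ?case
    using poly_deg_mult_eq_0[OF poly_deg_relation[of r]] by (simp add: poly_deg_def frag_eval_add)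
qed (simp add: poly_deg_def)

text \<open>Total on the ring, with value 0 on products of other than four generators; the local
  degree is its restriction to degree 4.\<close>

lift_definition chow_deg :: "3 chow \<Rightarrow> int" is poly_deg
proof -
  fix p q :: "(bit ^ 3) int_mpoly"
  assume "chow_eq p q"
  then have "poly_deg (p - q) = 0"
    by (simp add: chow_eq_def poly_deg_span)
  then show "poly_deg p = poly_deg q"
    by (simp add: poly_deg_def frag_eval_diff)
qed

lemma chow_deg_add: "chow_deg (x + y) = chow_deg x + chow_deg y"
  by transfer (simp add: poly_deg_def frag_eval_add)

lemma chow_deg_0 [simp]: "chow_deg 0 = 0"
  using chow_deg_add[of 0 0] by simp

lemma chow_deg_uminus: "chow_deg (- x) = - chow_deg x"
  using chow_deg_add[of x "- x"] by simp

lemma chow_deg_sum_list: "chow_deg (sum_list xs) = sum_list (map chow_deg xs)"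
  by (induction xs) (simp_all add: chow_deg_add)

lemma chow_deg_prod_C: "chow_deg (prod_list (map C xs)) = list_deg xs"
  by (simp add: prod_list_C chow_deg.abs_eq poly_deg_prod_mvar)

lemma list_deg_strict_chain:
  fixes a b c d :: "bit ^ 3"
  assumes "a < b" "b < c" "c < d"
  shows "list_deg [a, b, c, d] = 1"
proof -
  have "weight a < weight b" "weight b < weight c" "weight c < weight d" "weight d \<le> 3"
    using assms weight_le[of d] by (simp_all add: weight_strict_mono)
  then have weights: "weight a = 0" "weight b = 1" "weight c = 2" "weight d = 3"
    by linarith+
  have "chain (set [a, b, c, d])"
    using assms by (auto simp: chain_def intro: less_imp_le less_trans)
  moreover have "[0..<Suc CARD(3)] = [0, 1, 2, 3]"
    by (simp add: upt_rec)
  ultimately show ?thesis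
    by (simp add: list_deg_def weights)
qed

lemma chow_deg_chain:
  fixes v :: "nat \<Rightarrow> bit ^ 3"
  assumes "\<And>i. i < 3 \<Longrightarrow> v i < v (Suc i)"
  shows "chow_deg (\<Prod>i\<le>3. C (v i)) = 1"
proof -
  have "{..3 :: nat} = {0, 1, 2, 3}"
    by auto
  then have "(\<Prod>i\<le>3. C (v i)) = prod_list (map C [v 0, v 1, v 2, v 3])"
    by (simp add: mult.assoc del: ideal.scale_scale)
  moreover have "v 0 < v 1" "v 1 < v 2" "v 2 < v 3"
    using assms[of 0] assms[of 1, unfolded Suc_1] assms[of 2] by simp_all
  then have "list_deg [v 0, v 1, v 2, v 3] = 1"
    by (rule list_deg_strict_chain)
  ultimately show ?thesis
    by (simp only: chow_deg_prod_C)
qed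

lemma is_ldeg_chow_deg: "is_ldeg (restrict chow_deg (chow_graded (CARD(3) + 1)))"
  unfolding is_ldeg_def
proof (intro conjI ballI allI impI)
  fix v :: "nat \<Rightarrow> bit ^ 3" assume v: "\<forall>i<CARD(3). v i < v (Suc i)"
  have "(\<Prod>i\<le>k. C (v i)) = prod_list (map C (map v [0..<Suc k]))" for k
    by (induction k) simp_all
  from this[of "CARD(3)"] chow_graded_prod_C[of "map v [0..<Suc CARD(3)]"]
  have "(\<Prod>i\<le>CARD(3). C (v i)) \<in> chow_graded (CARD(3) + 1)"
    by (simp only: length_map length_upt diff_zero Suc_eq_plus1)
  then show "restrict chow_deg (chow_graded (CARD(3) + 1)) (\<Prod>i\<le>CARD(3). C (v i)) = 1"
    using chow_deg_chain[of v] v by simp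
qed (simp_all add: chow_graded_add chow_deg_add)

lemma ldeg_int_eq:
  fixes x :: "3 chow"
  assumes "x \<in> chow_graded 4"
  shows "ldeg_int x = chow_deg x"
proof -
  have eq: "ldeg_int = restrict chow_deg (chow_graded (CARD(3) + 1))"
    unfolding ldeg_int_def
    by (rule the_equality, rule is_ldeg_chow_deg, rule is_ldeg_unique[OF _ is_ldeg_chow_deg])
  show ?thesis
    unfolding eq using assms by simp
qed

section \<open>Rational coefficients\<close>

lemma tens_mult: "tens a b * tens a' b' = tens (a * a') (b * b')"
  by transfer (rule tensor_eq_refl, simp only: frag_mult_of_of fst_conv snd_conv)

lemma chow_rat_graded_add_tens:
  assumes "z \<in> chow_rat_graded k" "x \<in> chow_graded k"
  shows "z + tens x q \<in> chow_rat_graded k"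
proof -
  obtain m :: nat and y r where z: "z = (\<Sum>i<m. tens (y i) (r i))" "\<forall>i<m. y i \<in> chow_graded k"
    using assms(1) unfolding chow_rat_graded_def by blast
  have "z + tens x q = (\<Sum>i<Suc m. tens ((y(m := x)) i) ((r(m := q)) i))"
    by (simp add: z(1))
  moreover have "\<forall>i<Suc m. (y(m := x)) i \<in> chow_graded k"
    using z(2) assms(2) by (simp add: less_Suc_eq)
  ultimately show ?thesis
    unfolding chow_rat_graded_def by blast
qed

lemma chow_rat_graded_0: "0 \<in> chow_rat_graded k"
  unfolding chow_rat_graded_def by (rule CollectI, rule exI[of _ 0]) simp

lemma tens_in_graded: "x \<in> chow_graded k \<Longrightarrow> tens x q \<in> chow_rat_graded k"
  using chow_rat_graded_add_tens[OF chow_rat_graded_0, of x k q] by simp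

lemma chow_rat_graded_induct [consumes 1, case_names zero add_tens]:
  assumes z: "z \<in> chow_rat_graded k"
    and zero: "P 0"
    and add: "\<And>z x q. \<lbrakk>z \<in> chow_rat_graded k; P z; x \<in> chow_graded k\<rbrakk> \<Longrightarrow> P (z + tens x q)"
  shows "P z"
proof -
  obtain m :: nat and x q where z: "z = (\<Sum>i<m. tens (x i) (q i))" "\<forall>i<m. x i \<in> chow_graded k"
    using z unfolding chow_rat_graded_def by blast
  have "j \<le> m \<Longrightarrow> (\<Sum>i<j. tens (x i) (q i)) \<in> chow_rat_graded k \<and> P (\<Sum>i<j. tens (x i) (q i))" for j
    using z(2) by (induction j) (auto simp: zero chow_rat_graded_0 intro: add chow_rat_graded_add_tens)
  then show ?thesis
    by (simp add: z(1))
qed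

lemma chow_rat_graded_add:
  assumes "z \<in> chow_rat_graded k" "z' \<in> chow_rat_graded k"
  shows "z + z' \<in> chow_rat_graded k"
  using assms(2)
proof (induction z' rule: chow_rat_graded_induct)
  case (add_tens z' x q)
  then show ?case
    using chow_rat_graded_add_tens[of "z + z'"] by (simp add: add.assoc)
qed (simp add: assms(1))

lemma chow_rat_graded_scale:
  "z \<in> chow_rat_graded k \<Longrightarrow> tens 1 q * z \<in> chow_rat_graded k"
proof (induction z rule: chow_rat_graded_induct)
  case zero
  then show ?case by (simp add: chow_rat_graded_0)
next
  case (add_tens z x r)
  then show ?case
    by (simp add: distrib_left tens_mult chow_rat_graded_add_tens)
qed

definition frag_deg :: "(3 chow \<times> rat \<Rightarrow>\<^sub>0 int) \<Rightarrow> rat"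
  where "frag_deg = frag_eval (\<lambda>z. of_int (chow_deg (fst z)) * snd z)"

text \<open>Degree times rational factor is biadditive in the pair, hence factors through the tensor
  product.\<close>

lemma frag_deg_span: "f \<in> frag.span tensor_relations \<Longrightarrow> frag_deg f = 0"
proof (induction rule: frag.span_induct_alt)
  case (step c r f)
  have "frag_deg r = 0"
    using step.hyps(1) unfolding tensor_relations_def
    by (auto simp: frag_deg_def frag_eval_diff chow_deg_add distrib_left distrib_right)
  then show ?case
    using step.IH by (simp add: frag_deg_def frag_eval_add frag_eval_cmul)
qed (simp add: frag_deg_def)

lift_definition tensor_deg :: "3 chow_rat \<Rightarrow> rat" is frag_deg
proof -
  fix f g :: "3 chow \<times> rat \<Rightarrow>\<^sub>0 int"
  assume "tensor_eq f g"
  then have "frag_deg (f - g) = 0"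
    by (simp add: tensor_eq_def frag_deg_span)
  then show "frag_deg f = frag_deg g"
    by (simp add: frag_deg_def frag_eval_diff)
qed

lemma tensor_deg_add: "tensor_deg (x + y) = tensor_deg x + tensor_deg y"
  by transfer (simp add: frag_deg_def frag_eval_add)

lemma tensor_deg_tens: "tensor_deg (tens x q) = of_int (chow_deg x) * q"
  by transfer (simp add: frag_deg_def)

lemma tensor_deg_0 [simp]: "tensor_deg 0 = 0"
  using tensor_deg_add[of 0 0] by simp

lemma tensor_deg_scale: "z \<in> chow_rat_graded k \<Longrightarrow> tensor_deg (tens 1 q * z) = q * tensor_deg z"
proof (induction z rule: chow_rat_graded_induct)
  case (add_tens z x r)
  then show ?case
    by (simp only: distrib_left tens_mult tensor_deg_add tensor_deg_tens mult_1 mult.left_commute)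
qed simp

lemma is_ldeg_extension_tensor_deg:
  "is_ldeg_extension (restrict tensor_deg (chow_rat_graded (CARD(3) + 1)))"
  unfolding is_ldeg_extension_def
proof (intro conjI ballI allI)
  fix q and z :: "3 chow_rat" assume z: "z \<in> chow_rat_graded (CARD(3) + 1)"
  then have "tens 1 q * z \<in> chow_rat_graded (CARD(3) + 1)"
    by (rule chow_rat_graded_scale)
  then show "restrict tensor_deg (chow_rat_graded (CARD(3) + 1)) (tens 1 q * z) =
      q * restrict tensor_deg (chow_rat_graded (CARD(3) + 1)) z"
    using z by (simp only: restrict_apply' tensor_deg_scale)
next
  fix x :: "3 chow" assume "x \<in> chow_graded (CARD(3) + 1)"
  then show "restrict tensor_deg (chow_rat_graded (CARD(3) + 1)) (tens x 1) = of_int (ldeg_int x)"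
    by (simp add: tens_in_graded tensor_deg_tens ldeg_int_eq)
qed (simp_all add: chow_rat_graded_add tensor_deg_add)

text \<open>Since \<open>tens x q = tens 1 q * tens x 1\<close>, additivity and scaling reduce
  everything to \<open>tens x 1\<close>, where \<open>ldeg_int\<close> prescribes the value.\<close>

lemma is_ldeg_extension_unique:
  fixes f g :: "'n::finite chow_rat \<Rightarrow> rat"
  assumes f: "is_ldeg_extension f" and g: "is_ldeg_extension g"
  shows "f = g"
proof (rule extensionalityI)
  let ?G = "chow_rat_graded (CARD('n) + 1) :: 'n chow_rat set"
  show "f \<in> extensional ?G" "g \<in> extensional ?G"
    using assms by (simp_all add: is_ldeg_extension_def)
  fix z assume "z \<in> ?G"
  then show "f z = g z"
  proof (induction rule: chow_rat_graded_induct)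
    case zero
    have h0: "h 0 = 0" if "is_ldeg_extension h" for h :: "'n chow_rat \<Rightarrow> rat"
    proof -
      have "h (0 + 0) = h 0 + h 0"
        using that chow_rat_graded_0 unfolding is_ldeg_extension_def by blast
      then show ?thesis by simp
    qed
    show ?case
      by (simp only: h0[OF f] h0[OF g])
  next
    case (add_tens z x q)
    have step: "h (z + tens x q) = h z + q * of_int (ldeg_int x)" if "is_ldeg_extension h" for h
    proof -
      have "h (z + tens x q) = h z + h (tens x q)"
        using that add_tens tens_in_graded unfolding is_ldeg_extension_def by blast
      moreover have "h (tens 1 q * tens x 1) = q * h (tens x 1)"
        using that add_tens tens_in_graded unfolding is_ldeg_extension_def by blast
      moreover have "h (tens x 1) = of_int (ldeg_int x)"
        using that add_tens unfolding is_ldeg_extension_def by blast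
      ultimately show ?thesis
        by (simp add: tens_mult)
    qed
    show ?case
      by (simp only: step[OF f] step[OF g] add_tens.IH)
  qed
qed

lemma ldeg_tens:
  fixes x :: "3 chow"
  assumes "x \<in> chow_graded 4"
  shows "ldeg (tens x 1) = of_int (chow_deg x)"
proof -
  have eq: "ldeg = restrict tensor_deg (chow_rat_graded (CARD(3) + 1))"
    unfolding ldeg_def
    by (rule the_equality, rule is_ldeg_extension_tensor_deg,
        rule is_ldeg_extension_unique[OF _ is_ldeg_extension_tensor_deg])
  show ?thesis
    unfolding eq using assms by (simp add: tens_in_graded tensor_deg_tens)
qed

section \<open>Products of the elements F\<close>

definition bits_odd :: "bits3 \<Rightarrow> bits3 \<Rightarrow> bool"
  where "bits_odd v w = (case v of (a, b, c) \<Rightarrow> case w of (a', b', c') \<Rightarrow>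
    (a \<and> a') \<noteq> ((b \<and> b') \<noteq> (c \<and> c')))"

lemma dot_of_bits: "dot (of_bits v) (of_bits w) = 0 \<longleftrightarrow> \<not> bits_odd v w"
  by (auto simp: dot_def sum_3 bits_odd_def split: prod.split)

text \<open>The accumulator \<open>xs\<close> holds the indices of the generators chosen so far, one
  for each factor \<open>F\<close> already expanded.\<close>

fun signed_sum :: "bits3 list \<Rightarrow> (bits3 list \<Rightarrow> int) \<Rightarrow> bits3 list \<Rightarrow> int"
  where "signed_sum [] f xs = f xs"
  | "signed_sum (v # vs) f xs =
      (\<Sum>w\<leftarrow>cube. (if bits_odd v w then -1 else 1) * signed_sum vs f (xs @ [w]))"

lemma prod_C_mult_F:
  "prod_list (map C xs) * (F (of_bits v) * y) =
    (\<Sum>w\<leftarrow>cube. (if bits_odd v w then - (prod_list (map C (xs @ [of_bits w])) * y)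
      else prod_list (map C (xs @ [of_bits w])) * y))"
proof -
  have "F (of_bits v) = (\<Sum>w\<leftarrow>cube. if bits_odd v w then - C (of_bits w) else C (of_bits w))"
    unfolding F_def sum_UNIV_of_bits dot_of_bits by (rule arg_cong[where f = sum_list]) simp
  then have "prod_list (map C xs) * (F (of_bits v) * y) = (\<Sum>w\<leftarrow>cube.
      prod_list (map C xs) * ((if bits_odd v w then - C (of_bits w) else C (of_bits w)) * y))"
    by (simp only: sum_list_const_mult sum_list_mult_const)
  then show ?thesis
    by (simp only:) (rule arg_cong[where f = sum_list], simp add: mult.assoc del: ideal.scale_scale)
qed

lemma chow_deg_prod_F:
  "chow_deg (prod_list (map C (map of_bits xs)) * prod_list (map F (map of_bits vs)))
    = signed_sum vs bits_deg xs"
proof (induction vs arbitrary: xs)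
  case Nil
  then show ?case
    by (simp only: list.map prod_list.Nil mult_1_right chow_deg_prod_C list_deg_of_bits
        signed_sum.simps)
next
  case (Cons v vs)
  have IH: "chow_deg (prod_list (map C (map of_bits xs @ [of_bits w])) *
      prod_list (map F (map of_bits vs))) = signed_sum vs bits_deg (xs @ [w])" for w
    using Cons.IH[of "xs @ [w]"] by simp
  have "chow_deg (prod_list (map C (map of_bits xs)) * prod_list (map F (map of_bits (v # vs)))) =
      sum_list (map chow_deg (map (\<lambda>w. if bits_odd v w
        then - (prod_list (map C (map of_bits xs @ [of_bits w])) * prod_list (map F (map of_bits vs)))
        else prod_list (map C (map of_bits xs @ [of_bits w])) * prod_list (map F (map of_bits vs)))
      cube))"
    by (simp only: list.map prod_list.Cons prod_C_mult_F chow_deg_sum_list)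
  also have "\<dots> = signed_sum (v # vs) bits_deg xs"
    unfolding map_map[of chow_deg] signed_sum.simps
    by (rule arg_cong[where f = sum_list], rule map_cong[OF refl])
      (simp only: o_apply if_distrib[of chow_deg] chow_deg_uminus IH, simp)
  finally show ?case .
qed

text \<open>The description of \<open>ldeg\<close> fixes meaningful values only on the degree 4
  piece, so membership has to accompany the computed degree.\<close>

lemma prod_F_graded:
  "prod_list (map C xs) * prod_list (map F vs) \<in> chow_graded (length xs + length vs)"
proof (induction vs arbitrary: xs)
  case Nil
  then show ?case
    using chow_graded_prod_C[of xs] by simp
next
  case (Cons v vs)
  have "prod_list (map C xs) * prod_list (map F (v # vs)) =
      (\<Sum>w\<in>UNIV. if dot v w = 0 then prod_list (map C (xs @ [w])) * prod_list (map F vs)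
        else - (prod_list (map C (xs @ [w])) * prod_list (map F vs)))"
    unfolding F_def[of v] list.map prod_list.Cons sum_distrib_left sum_distrib_right
    by (rule sum.cong) (simp_all add: mult.assoc del: ideal.scale_scale)
  also have "\<dots> \<in> chow_graded (length xs + length (v # vs))"
    using Cons.IH[of "xs @ [_]"] by (intro chow_graded_sum) (auto intro: chow_graded_uminus)
  finally show ?case .
qed

text \<open>
  Evaluating \<open>signed_sum\<close> for all 4096 quadruples separately is infeasible, hence the fast transform on
  perfect binary trees, in which each level of the tree is one bit of a quadruple.
\<close>

datatype tree = Leaf int | Node tree tree

fun tree_map2 :: "(int \<Rightarrow> int \<Rightarrow> int) \<Rightarrow> tree \<Rightarrow> tree \<Rightarrow> tree"
  where "tree_map2 f (Leaf x) (Leaf y) = Leaf (f x y)"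
  | "tree_map2 f (Node a b) (Node c d) = Node (tree_map2 f a c) (tree_map2 f b d)"
  | "tree_map2 f _ _ = Leaf 0"

text \<open>One stage of the transform: sums for character bit 0 on the left, differences for bit 1
  on the right.\<close>

definition butterfly :: "tree \<Rightarrow> tree \<Rightarrow> tree"
  where "butterfly s t = Node (tree_map2 (+) s t) (tree_map2 (-) s t)"

definition cube_fold :: "('a \<Rightarrow> 'a \<Rightarrow> 'a) \<Rightarrow> (bits3 \<Rightarrow> 'a) \<Rightarrow> 'a"
  where "cube_fold g h =
    g (g (g (h (False, False, False)) (h (False, False, True)))
         (g (h (False, True, False)) (h (False, True, True))))
      (g (g (h (True, False, False)) (h (True, False, True)))
         (g (h (True, True, False)) (h (True, True, True))))"

text \<open>
  The eight recursive calls are written out because \<open>code_simp\<close> would evaluate the body of an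
  abstraction symbolically.
\<close>

fun build :: "(tree \<Rightarrow> tree \<Rightarrow> tree) \<Rightarrow> nat \<Rightarrow> (bits3 list \<Rightarrow> int) \<Rightarrow> bits3 list \<Rightarrow> tree"
  where "build g 0 f xs = Leaf (f xs)"
  | "build g (Suc n) f xs =
      g (g (g (build g n f (xs @ [(False, False, False)])) (build g n f (xs @ [(False, False, True)])))
           (g (build g n f (xs @ [(False, True, False)])) (build g n f (xs @ [(False, True, True)]))))
        (g (g (build g n f (xs @ [(True, False, False)])) (build g n f (xs @ [(True, False, True)])))
           (g (build g n f (xs @ [(True, True, False)])) (build g n f (xs @ [(True, True, True)]))))"

lemma build_Suc: "build g (Suc n) f xs = cube_fold g (\<lambda>v. build g n f (xs @ [v]))"
  by (simp add: cube_fold_def)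

fun child :: "bool \<Rightarrow> tree \<Rightarrow> tree"
  where "child b (Node s t) = (if b then t else s)"
  | "child b (Leaf x) = Leaf x"

fun entry :: "tree \<Rightarrow> bits3 list \<Rightarrow> int"
  where "entry (Leaf x) [] = x"
  | "entry (Node _ _) [] = 0"
  | "entry t ((a, b, c) # vs) = entry (child c (child b (child a t))) vs"

text \<open>\<open>tree_map2\<close> answers \<open>Leaf 0\<close> for mismatched shapes, so the
  rules for reading its entries are stated for perfect trees of equal depth.\<close>

fun full :: "nat \<Rightarrow> tree \<Rightarrow> bool"
  where "full 0 (Leaf _) = True"
  | "full (Suc n) (Node s t) = (full n s \<and> full n t)"
  | "full _ _ = False"

lemma full_0E: "full 0 t \<Longrightarrow> (\<And>x. t = Leaf x \<Longrightarrow> P) \<Longrightarrow> P"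
  by (cases t) auto

lemma full_SucE: "full (Suc n) t \<Longrightarrow> (\<And>a b. t = Node a b \<Longrightarrow> full n a \<Longrightarrow> full n b \<Longrightarrow> P) \<Longrightarrow> P"
  by (cases t) auto

lemma full_map2: "full n s \<Longrightarrow> full n t \<Longrightarrow> full n (tree_map2 f s t)"
  by (induction n arbitrary: s t) (auto elim!: full_0E full_SucE)

lemma full_butterfly: "full n s \<Longrightarrow> full n t \<Longrightarrow> full (Suc n) (butterfly s t)"
  by (simp add: butterfly_def full_map2)

lemma three_mult_Suc: "3 * Suc n = Suc (Suc (Suc (3 * n)))"
  by simp

lemma full_build: "full (3 * n) (build butterfly n f xs)"
  by (induction n arbitrary: xs)
    (simp_all add: full_butterfly three_mult_Suc del: mult_Suc_right)

lemma full_child: "full (Suc n) t \<Longrightarrow> full n (child b t)"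
  by (auto elim!: full_SucE)

lemma child_map2: "full (Suc n) s \<Longrightarrow> full (Suc n) t \<Longrightarrow>
    child b (tree_map2 f s t) = tree_map2 f (child b s) (child b t)"
  by (auto elim!: full_SucE)

lemma entry_map2: "full (3 * length vs) s \<Longrightarrow> full (3 * length vs) t \<Longrightarrow>
    entry (tree_map2 f s t) vs = f (entry s vs) (entry t vs)"
proof (induction vs arbitrary: s t)
  case Nil
  then show ?case
    by (auto elim!: full_0E)
next
  case (Cons v vs)
  obtain a b c where v: "v = (a, b, c)"
    by (cases v)
  have s: "full (Suc (Suc (Suc (3 * length vs)))) s" and t: "full (Suc (Suc (Suc (3 * length vs)))) t"
    using Cons.prems by (simp_all add: three_mult_Suc del: mult_Suc_right)
  show ?case
    using Cons.IH full_child[OF full_child[OF full_child[OF s]]]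
      full_child[OF full_child[OF full_child[OF t]]]
    by (simp add: v child_map2[OF s t] child_map2[OF full_child[OF s] full_child[OF t]]
        child_map2[OF full_child[OF full_child[OF s]] full_child[OF full_child[OF t]]])
qed

lemma child_butterfly: "child b (butterfly s t) = tree_map2 (if b then (-) else (+)) s t"
  by (simp add: butterfly_def)

text \<open>The character is a product of one sign per coordinate. Descending by \<open>a\<close>,
  \<open>b\<close>, \<open>c\<close> selects sum or difference at three nested levels of
  butterflies, which multiplies exactly these signs.\<close>

lemma entry_cube_fold_butterfly:
  assumes "\<And>w. full (3 * length vs) (h w)"
  shows "entry (cube_fold butterfly h) (v # vs) =
    (\<Sum>w\<leftarrow>cube. (if bits_odd v w then -1 else 1) * entry (h w) vs)"
proof -
  obtain a b c where v: "v = (a, b, c)"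
    by (cases v)
  show ?thesis
    using assms
    by (cases a; cases b; cases c)
      (simp_all add: v cube_fold_def child_butterfly child_map2[where n = "3 * length vs"]
        child_map2[where n = "Suc (3 * length vs)"] full_butterfly full_map2 entry_map2
        cube_def bits_odd_def)
qed

lemma entry_build_butterfly: "entry (build butterfly (length vs) f xs) vs = signed_sum vs f xs"
  by (induction vs arbitrary: xs) (simp_all add: build_Suc entry_cube_fold_butterfly full_build del: build.simps(2))

lemma entry_build_Node: "entry (build Node (length vs) f xs) vs = f (xs @ vs)"
proof (induction vs arbitrary: xs)
  case (Cons v vs)
  then show ?case
    by (cases v) auto
qed simp

section \<open>Orbits as sorted lists of binary codes\<close>

definition bits_perms :: "(bits3 \<Rightarrow> bits3) list"
  where "bits_perms = [\<lambda>(a, b, c). (a, b, c), \<lambda>(a, b, c). (a, c, b), \<lambda>(a, b, c). (b, a, c),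
    \<lambda>(a, b, c). (b, c, a), \<lambda>(a, b, c). (c, a, b), \<lambda>(a, b, c). (c, b, a)]"

text \<open>The binary value of the digits, for instance 5 for 101. Its linear order makes sorting a
  normal form for multisets.\<close>

definition bits_code :: "bits3 \<Rightarrow> int"
  where "bits_code v = (case v of (a, b, c) \<Rightarrow>
    (if a then 4 else 0) + ((if b then 2 else 0) + (if c then 1 else 0)))"

lemma inj_bits_code: "inj bits_code"
  by (rule injI) (auto simp: bits_code_def split: prod.splits if_splits)

lemma permute_basis_of_bits:
  assumes "\<tau> permutes UNIV"
  shows "\<exists>\<rho>\<in>set bits_perms. \<forall>v. permute_basis \<tau> (of_bits v) = of_bits (\<rho> v)"
proof -
  have "inj (inv \<tau>)"
    using assms permutes_inv permutes_inj by blast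
  then have dist: "inv \<tau> 1 \<noteq> inv \<tau> 2" "inv \<tau> 1 \<noteq> inv \<tau> 3" "inv \<tau> 2 \<noteq> inv \<tau> 3"
    by (simp_all add: inj_eq)
  consider "inv \<tau> 1 = 1" "inv \<tau> 2 = 2" "inv \<tau> 3 = 3" | "inv \<tau> 1 = 1" "inv \<tau> 2 = 3" "inv \<tau> 3 = 2"
    | "inv \<tau> 1 = 2" "inv \<tau> 2 = 1" "inv \<tau> 3 = 3" | "inv \<tau> 1 = 2" "inv \<tau> 2 = 3" "inv \<tau> 3 = 1"
    | "inv \<tau> 1 = 3" "inv \<tau> 2 = 1" "inv \<tau> 3 = 2" | "inv \<tau> 1 = 3" "inv \<tau> 2 = 2" "inv \<tau> 3 = 1"
    using dist exhaust_3[of "inv \<tau> 1"] exhaust_3[of "inv \<tau> 2"] exhaust_3[of "inv \<tau> 3"] by metis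
  then show ?thesis
    by cases (auto simp: bits_perms_def permute_basis_def vec_eq_iff forall_3)
qed

lemma bits_perm_permute_basis:
  assumes "\<rho> \<in> set bits_perms"
  shows "\<exists>\<tau>. \<tau> permutes UNIV \<and> (\<forall>v. permute_basis \<tau> (of_bits v) = of_bits (\<rho> v))"
proof -
  have *: "\<exists>\<tau>. \<tau> permutes UNIV \<and> (\<forall>v. permute_basis \<tau> (of_bits v) = of_bits (\<rho> v))"
    if "i \<noteq> j" "i \<noteq> k" "j \<noteq> k"
      and \<rho>: "\<And>v. of_bits (\<rho> v) = vector [of_bits v $ i, of_bits v $ j, of_bits v $ k]"
    for i j k :: 3
  proof -
    \<comment> \<open>\<open>permute_basis\<close> reads coordinates through the inverse, so the
      witness is \<open>inv \<sigma>\<close>.\<close>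
    define \<sigma> :: "3 \<Rightarrow> 3" where "\<sigma> l = (if l = 1 then i else if l = 2 then j else k)" for l
    have \<sigma>: "\<sigma> 1 = i" "\<sigma> 2 = j" "\<sigma> 3 = k"
      by (simp_all add: \<sigma>_def)
    then have "inj \<sigma>"
      using that(1-3) by (auto simp: inj_def forall_3)
    then have "bij \<sigma>"
      by (simp add: finite_UNIV_inj_surj bij_def)
    then have "inv \<sigma> permutes UNIV" and inv: "inv (inv \<sigma>) = \<sigma>"
      by (auto intro: bij_imp_permutes bij_imp_bij_inv inv_inv_eq)
    moreover have "permute_basis (inv \<sigma>) (of_bits v) = of_bits (\<rho> v)" for v
      unfolding permute_basis_def inv \<rho> by (simp add: vec_eq_iff forall_3 \<sigma> del: of_bits_nth)
    ultimately show ?thesis by blast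
  qed
  consider "\<rho> = (\<lambda>(a, b, c). (a, b, c))" | "\<rho> = (\<lambda>(a, b, c). (a, c, b))"
    | "\<rho> = (\<lambda>(a, b, c). (b, a, c))" | "\<rho> = (\<lambda>(a, b, c). (b, c, a))"
    | "\<rho> = (\<lambda>(a, b, c). (c, a, b))" | "\<rho> = (\<lambda>(a, b, c). (c, b, a))"
    using assms unfolding bits_perms_def by (simp only: list.set insert_iff empty_iff) blast
  then show ?thesis
  proof cases
    case 1
    then show ?thesis by (intro *[of 1 2 3]) (simp_all add: split_beta vec_eq_iff forall_3)
  next
    case 2
    then show ?thesis by (intro *[of 1 3 2]) (simp_all add: split_beta)
  next
    case 3
    then show ?thesis by (intro *[of 2 1 3]) (simp_all add: split_beta)
  next
    case 4
    then show ?thesis by (intro *[of 2 3 1]) (simp_all add: split_beta)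
  next
    case 5
    then show ?thesis by (intro *[of 3 1 2]) (simp_all add: split_beta)
  next
    case 6
    then show ?thesis by (intro *[of 3 2 1]) (simp_all add: split_beta)
  qed
qed

lemma act_eq_permute_list:
  assumes "\<sigma> permutes {..<4}" "length W = 4"
  shows "act \<sigma> \<tau> W = permute_list \<sigma> (map (permute_basis \<tau>) W)"
proof -
  have "\<sigma> k < 4" if "k < 4" for k
    using permutes_in_image[OF assms(1), of k] that by simp
  moreover have "[0..<4] = [0, 1, 2, 3]"
    by (simp add: upt_rec)
  ultimately show ?thesis
    by (simp add: act_def permute_list_def assms(2))
qed

lemma in_orbit_iff_mset:
  assumes "length V = 4" "length W = 4"
  shows "in_orbit V W \<longleftrightarrow> (\<exists>\<tau>. \<tau> permutes UNIV \<and> mset V = mset (map (permute_basis \<tau>) W))"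
proof -
  have set4: "{0, 1, 2, 3 :: nat} = {..<4}"
    by auto
  have "(\<exists>\<sigma>. \<sigma> permutes {..<4} \<and> V = act \<sigma> \<tau> W) \<longleftrightarrow> mset V = mset (map (permute_basis \<tau>) W)" for \<tau>
  proof
    assume "\<exists>\<sigma>. \<sigma> permutes {..<4} \<and> V = act \<sigma> \<tau> W"
    then obtain \<sigma> where "\<sigma> permutes {..<4}" "V = permute_list \<sigma> (map (permute_basis \<tau>) W)"
      using act_eq_permute_list assms(2) by blast
    then show "mset V = mset (map (permute_basis \<tau>) W)"
      using mset_permute_list[of \<sigma> "map (permute_basis \<tau>) W"] assms(2) by simp
  next
    assume "mset V = mset (map (permute_basis \<tau>) W)"
    then obtain \<sigma> where "\<sigma> permutes {..<length (map (permute_basis \<tau>) W)}"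
      "permute_list \<sigma> (map (permute_basis \<tau>) W) = V"
      by (rule mset_eq_permutation)
    then show "\<exists>\<sigma>. \<sigma> permutes {..<4} \<and> V = act \<sigma> \<tau> W"
      using act_eq_permute_list assms(2) by (metis length_map)
  qed
  then show ?thesis
    unfolding in_orbit_def set4 by blast
qed

definition orbit_codes :: "bits3 list \<Rightarrow> int list list"
  where "orbit_codes ws = map (\<lambda>\<rho>. sort (map bits_code (map \<rho> ws))) bits_perms"

text \<open>Every \<open>\<tau>\<close> acts as some member of \<open>bits_perms\<close> and every
  member arises so; comparing sorted codes then decides equality of multisets.\<close>

lemma in_orbit_iff_codes:
  assumes "length vs = 4" "length ws = 4"
  shows "in_orbit (map of_bits vs) (map of_bits ws) \<longleftrightarrow>
    sort (map bits_code vs) \<in> set (orbit_codes ws)"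
proof -
  have inj: "inj of_bits"
    using bij_of_bits by (rule bij_is_inj)
  have "in_orbit (map of_bits vs) (map of_bits ws) \<longleftrightarrow>
      (\<exists>\<rho>\<in>set bits_perms. mset (map of_bits vs) = mset (map of_bits (map \<rho> ws)))"
  proof -
    have "map (permute_basis \<tau>) (map of_bits ws) = map of_bits (map \<rho> ws)"
      if "\<forall>v. permute_basis \<tau> (of_bits v) = of_bits (\<rho> v)" for \<tau> \<rho>
      by (simp only: list.map_comp o_def that[rule_format])
    then show ?thesis
      using assms permute_basis_of_bits bits_perm_permute_basis
      by (subst in_orbit_iff_mset) (simp, simp, metis)
  qed
  also have "\<dots> \<longleftrightarrow> (\<exists>\<rho>\<in>set bits_perms. mset vs = mset (map \<rho> ws))"
    unfolding mset_map[of of_bits] using multiset.inj_map[OF inj] by (metis injD)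
  also have "\<dots> \<longleftrightarrow> (\<exists>\<rho>\<in>set bits_perms. mset (map bits_code vs) = mset (map bits_code (map \<rho> ws)))"
    unfolding mset_map[of bits_code] using multiset.inj_map[OF inj_bits_code] by (metis injD)
  also have "\<dots> \<longleftrightarrow> sort (map bits_code vs) \<in> set (orbit_codes ws)"
    unfolding orbit_codes_def set_map image_iff
    by (metis mset_sort properties_for_sort sorted_sort)
  finally show ?thesis .
qed

text \<open>The lists are the orbits in sorted form. S_3 fixes the first and the last multiset; each
  other representative is fixed by one transposition, hence three lists.\<close>

definition code_value :: "int list \<Rightarrow> int"
  where "code_value k =
   (if k \<in> set [[1, 2, 4, 7]] then -64
    else if k \<in> set [[1, 2, 5, 6], [1, 3, 4, 6], [2, 3, 4, 5]] then -64
    else if k \<in> set [[1, 3, 5, 7], [2, 3, 6, 7], [4, 5, 6, 7]] then -64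
    else if k \<in> set [[1, 6, 6, 7], [2, 5, 5, 7], [3, 3, 4, 7]] then 128
    else if k \<in> set [[1, 7, 7, 7], [2, 7, 7, 7], [4, 7, 7, 7]] then 128
    else if k \<in> set [[3, 3, 5, 6], [3, 5, 5, 6], [3, 5, 6, 6]] then 128
    else if k \<in> set [[3, 5, 7, 7], [3, 6, 7, 7], [5, 6, 7, 7]] then -128
    else if k \<in> set [[7, 7, 7, 7]] then 512
    else 0)"

lemma set_orbit_codes:
  "set (orbit_codes [(True, False, False), (False, True, False), (False, False, True), (True, True, True)]) =
     set [[1, 2, 4, 7]]"
  "set (orbit_codes [(True, False, False), (False, True, False), (True, False, True), (False, True, True)]) =
     set [[1, 2, 5, 6], [1, 3, 4, 6], [2, 3, 4, 5]]"
  "set (orbit_codes [(True, False, False), (True, True, False), (True, False, True), (True, True, True)]) =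
     set [[1, 3, 5, 7], [2, 3, 6, 7], [4, 5, 6, 7]]"
  "set (orbit_codes [(True, False, False), (False, True, True), (False, True, True), (True, True, True)]) =
     set [[1, 6, 6, 7], [2, 5, 5, 7], [3, 3, 4, 7]]"
  "set (orbit_codes [(True, False, False), (True, True, True), (True, True, True), (True, True, True)]) =
     set [[1, 7, 7, 7], [2, 7, 7, 7], [4, 7, 7, 7]]"
  "set (orbit_codes [(True, True, False), (True, True, False), (True, False, True), (False, True, True)]) =
     set [[3, 3, 5, 6], [3, 5, 5, 6], [3, 5, 6, 6]]"
  "set (orbit_codes [(True, True, False), (True, False, True), (True, True, True), (True, True, True)]) =
     set [[3, 5, 7, 7], [3, 6, 7, 7], [5, 6, 7, 7]]"
  "set (orbit_codes [(True, True, True), (True, True, True), (True, True, True), (True, True, True)]) =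
     set [[7, 7, 7, 7]]"
  by code_simp+

definition orbit_value :: "bits3 list \<Rightarrow> int"
  where "orbit_value vs = code_value (sort (map bits_code vs))"

text \<open>All 4096 degrees in one evaluation: twelve stages of 4096 additions or subtractions on
  the left, the claimed values on the right.\<close>

lemma butterfly_table: "build butterfly 4 bits_deg [] = build Node 4 orbit_value []"
  by code_simp

lemma signed_sum_eq_orbit_value:
  assumes "length vs = 4"
  shows "signed_sum vs bits_deg [] = orbit_value vs"
  using entry_build_butterfly[of vs bits_deg "[]"] entry_build_Node[of vs _ "[]"] assms
  by (simp add: butterfly_table)

theorem theorem4p33:
  fixes V :: "(bit ^ 3) list"
  assumes "length V = 4"
  shows "ldeg (F_rat (V ! 0) * F_rat (V ! 1) * F_rat (V ! 2) * F_rat (V ! 3)) =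
    (if in_orbit V [digits 1 0 0, digits 0 1 0, digits 0 0 1, digits 1 1 1] then -64
     else if in_orbit V [digits 1 0 0, digits 0 1 0, digits 1 0 1, digits 0 1 1] then -64
     else if in_orbit V [digits 1 0 0, digits 1 1 0, digits 1 0 1, digits 1 1 1] then -64
     else if in_orbit V [digits 1 0 0, digits 0 1 1, digits 0 1 1, digits 1 1 1] then 128
     else if in_orbit V [digits 1 0 0, digits 1 1 1, digits 1 1 1, digits 1 1 1] then 128
     else if in_orbit V [digits 1 1 0, digits 1 1 0, digits 1 0 1, digits 0 1 1] then 128
     else if in_orbit V [digits 1 1 0, digits 1 0 1, digits 1 1 1, digits 1 1 1] then -128
     else if in_orbit V [digits 1 1 1, digits 1 1 1, digits 1 1 1, digits 1 1 1] then 512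
     else 0)"
proof -
  define vs where "vs = map (inv of_bits) V"
  have vs: "length vs = 4" "V = map of_bits vs"
    using assms bij_of_bits by (simp_all add: vs_def o_def bij_is_surj surj_f_inv_f)
  obtain a b c d where V: "V = [a, b, c, d]"
    using assms by (auto simp: length_Suc_conv numeral_eq_Suc)
  have "F_rat (V ! 0) * F_rat (V ! 1) * F_rat (V ! 2) * F_rat (V ! 3) =
      tens (prod_list (map F V)) 1"
    by (simp add: V F_rat_def tens_mult mult.assoc del: ideal.scale_scale)
  moreover have "prod_list (map F V) \<in> chow_graded 4"
    using prod_F_graded[of "[]" V] assms by simp
  moreover have "chow_deg (prod_list (map F V)) = orbit_value vs"
    using chow_deg_prod_F[of "[]" vs] signed_sum_eq_orbit_value[OF vs(1)] by (simp add: vs(2))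
  ultimately have ldeg: "ldeg (F_rat (V ! 0) * F_rat (V ! 1) * F_rat (V ! 2) * F_rat (V ! 3)) =
      of_int (orbit_value vs)"
    by (simp add: ldeg_tens)
  have orbit: "in_orbit V W \<longleftrightarrow> sort (map bits_code vs) \<in> set (orbit_codes ws)"
    if "W = map of_bits ws" "length ws = 4" for W ws
    unfolding vs(2) that(1) using vs(1) that(2) by (rule in_orbit_iff_codes)
  note orbits =
    orbit[of "[digits 1 0 0, digits 0 1 0, digits 0 0 1, digits 1 1 1]"
      "[(True, False, False), (False, True, False), (False, False, True), (True, True, True)]"]
    orbit[of "[digits 1 0 0, digits 0 1 0, digits 1 0 1, digits 0 1 1]"
      "[(True, False, False), (False, True, False), (True, False, True), (False, True, True)]"]
    orbit[of "[digits 1 0 0, digits 1 1 0, digits 1 0 1, digits 1 1 1]"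
      "[(True, False, False), (True, True, False), (True, False, True), (True, True, True)]"]
    orbit[of "[digits 1 0 0, digits 0 1 1, digits 0 1 1, digits 1 1 1]"
      "[(True, False, False), (False, True, True), (False, True, True), (True, True, True)]"]
    orbit[of "[digits 1 0 0, digits 1 1 1, digits 1 1 1, digits 1 1 1]"
      "[(True, False, False), (True, True, True), (True, True, True), (True, True, True)]"]
    orbit[of "[digits 1 1 0, digits 1 1 0, digits 1 0 1, digits 0 1 1]"
      "[(True, True, False), (True, True, False), (True, False, True), (False, True, True)]"]
    orbit[of "[digits 1 1 0, digits 1 0 1, digits 1 1 1, digits 1 1 1]"
      "[(True, True, False), (True, False, True), (True, True, True), (True, True, True)]"]
    orbit[of "[digits 1 1 1, digits 1 1 1, digits 1 1 1, digits 1 1 1]"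
      "[(True, True, True), (True, True, True), (True, True, True), (True, True, True)]"]
  show ?thesis
    \<comment> \<open>Folding the literal sets back into \<open>orbit_codes\<close> turns the
      conditions of \<open>code_value\<close> into the orbit conditions, case by case.\<close>
    unfolding ldeg orbit_value_def code_value_def set_orbit_codes[symmetric]
    by (simp add: orbits)
qed

end
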